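(* Let $p$ be a prime, $G=\mathbf Z_p^2$ and $k$ a field of characteristic $p$. Then $p$ is not a zero-divisor in the Witt–Burnside ring $\mathbf W_G(k)$.
   Context: Witt–Burnside rings. For a profinite group $G$, let $\mathcal F(G)$ be the set of isomorphism classes of finite discrete transitive $G$-sets (each is $G/H$, $H$ open). Write $U\le T$ if there is a $G$-map $T\to U$, and let $\varphi_T(U)$ be the number of $G$-maps $T\to U$ (for $G$ abelian, $\varphi_T(U)=\#U$ when $U\le T$). The $T$-th Witt polynomial is $W_T(\underline X)=\sum_{U\le T}\varphi_T(U)X_U^{\#T/\#U}$. By Dress–Siebeneicher there are unique polynomials $S_T,M_T\in\mathbf Z[\underline X,\underline Y]$ with $W_T(\underline X)+W_T(\underline Y)=W_T(\underline S)$ and $W_T(\underline X)W_T(\underline Y)=W_T(\underline M)$ for all $T$. For a commutative ring $A$, $\mathbf W_G(A)$ is the set $\prod_{T\in\mathcal F(G)}A$ with $\mathbf a+\mathbf b=(S_T(\mathbf a,\mathbf b))_T$ and $\mathbf a\mathbf b=(M_T(\mathbf a,\mathbf b))_T$; it is a commutative ring. *)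

theory Defs
  imports
    "HOL-Algebra.Group_Action"
    "HOL-Algebra.Ring"
    "HOL-Analysis.Function_Topology"
    "HOL-Analysis.Product_Topology"
    "HOL-Library.Poly_Mapping"
    "HOL-Computational_Algebra.Computational_Algebra"
begin

section \<open>Finite discrete transitive G-sets\<close>

text \<open>
  A topological group is given by a group \<open>G\<close> and a topology \<open>\<tau>\<close> with
  \<open>topspace \<tau> = carrier G\<close>. Finite G-sets are taken on finite sets of natural numbers; up to
  isomorphism every finite G-set is of this form, so that the isomorphism classes form a set.
\<close>

type_synonym 'g gset = "nat set \<times> ('g \<Rightarrow> nat \<Rightarrow> nat)"

definition fin_trans_gset :: "('g, 'z) monoid_scheme \<Rightarrow> 'g topology \<Rightarrow> 'g gset \<Rightarrow> bool" where
  "fin_trans_gset G \<tau> X \<longleftrightarrow>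
     finite (fst X) \<and> fst X \<noteq> {} \<and> transitive_action G (fst X) (snd X) \<and>
     continuous_map (prod_topology \<tau> (discrete_topology (fst X))) (discrete_topology (fst X))
       (\<lambda>(g, x). snd X g x)"

definition gmaps :: "('g, 'z) monoid_scheme \<Rightarrow> 'g gset \<Rightarrow> 'g gset \<Rightarrow> (nat \<Rightarrow> nat) set" where
  "gmaps G X Y = {f \<in> fst X \<rightarrow>\<^sub>E fst Y. \<forall>g\<in>carrier G. \<forall>x\<in>fst X. f (snd X g x) = snd Y g (f x)}"

definition gset_iso :: "('g, 'z) monoid_scheme \<Rightarrow> 'g topology \<Rightarrow> ('g gset \<times> 'g gset) set" where
  "gset_iso G \<tau> = {(X, Y). fin_trans_gset G \<tau> X \<and> fin_trans_gset G \<tau> Y \<and>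
     (\<exists>f\<in>gmaps G X Y. bij_betw f (fst X) (fst Y))}"

type_synonym 'g gclass = "'g gset set"

definition gclasses :: "('g, 'z) monoid_scheme \<Rightarrow> 'g topology \<Rightarrow> 'g gclass set" where
  "gclasses G \<tau> = {X. fin_trans_gset G \<tau> X} // gset_iso G \<tau>"

text \<open>The following depend only on the class, not on the chosen representative.\<close>

definition rep :: "'g gclass \<Rightarrow> 'g gset" where
  "rep T = (SOME X. X \<in> T)"

definition gcard :: "'g gclass \<Rightarrow> nat" where
  "gcard T = card (fst (rep T))"

definition gle :: "('g, 'z) monoid_scheme \<Rightarrow> 'g gclass \<Rightarrow> 'g gclass \<Rightarrow> bool" where
  "gle G U T \<longleftrightarrow> gmaps G (rep T) (rep U) \<noteq> {}"

definition num_gmaps :: "('g, 'z) monoid_scheme \<Rightarrow> 'g gclass \<Rightarrow> 'g gclass \<Rightarrow> nat" where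
  "num_gmaps G T U = card (gmaps G (rep T) (rep U))"


section \<open>Witt polynomials\<close>

text \<open>
  The value of \<open>W\<^sub>T\<close> at a family of elements of an arbitrary commutative ring. If \<open>U \<le> T\<close>, then
  \<open>#U\<close> divides \<open>#T\<close>.
\<close>

definition witt_poly ::
  "('g, 'z) monoid_scheme \<Rightarrow> 'g topology \<Rightarrow> 'g gclass \<Rightarrow> ('g gclass \<Rightarrow> 'r::comm_ring_1) \<Rightarrow> 'r" where
  "witt_poly G \<tau> T a =
     (\<Sum>U \<in> {U \<in> gclasses G \<tau>. gle G U T}.
        of_nat (num_gmaps G T U) * a U ^ (gcard T div gcard U))"

text \<open>
  Polynomials with integer coefficients in the variables \<open>X\<^sub>U\<close> (\<open>Inl U\<close>) and \<open>Y\<^sub>U\<close> (\<open>Inr U\<close>);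
  a monomial is a finitely supported family of exponents.
\<close>

type_synonym 'v zpoly = "('v \<Rightarrow>\<^sub>0 nat) \<Rightarrow>\<^sub>0 int"

definition zvar :: "'v \<Rightarrow> 'v zpoly" where
  "zvar v = Poly_Mapping.single (Poly_Mapping.single v 1) 1"

definition zeval :: "('v \<Rightarrow> 'r::comm_ring_1) \<Rightarrow> 'v zpoly \<Rightarrow> 'r" where
  "zeval a P =
     (\<Sum>m \<in> Poly_Mapping.keys P. of_int (Poly_Mapping.lookup P m) *
        (\<Prod>v \<in> Poly_Mapping.keys m. a v ^ Poly_Mapping.lookup m v))"

text \<open>
  The families \<open>(S\<^sub>T)\<close> and \<open>(M\<^sub>T)\<close>. For a profinite group they exist and are unique by the theorem
  of Dress and Siebeneicher; extensionality only fixes the values off the index set.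
\<close>

definition witt_sum ::
  "('g, 'z) monoid_scheme \<Rightarrow> 'g topology \<Rightarrow> 'g gclass \<Rightarrow> ('g gclass + 'g gclass) zpoly" where
  "witt_sum G \<tau> = (THE S. S \<in> extensional (gclasses G \<tau>) \<and>
     (\<forall>T\<in>gclasses G \<tau>.
        witt_poly G \<tau> T (\<lambda>U. zvar (Inl U)) + witt_poly G \<tau> T (\<lambda>U. zvar (Inr U)) =
        witt_poly G \<tau> T S))"

definition witt_prod ::
  "('g, 'z) monoid_scheme \<Rightarrow> 'g topology \<Rightarrow> 'g gclass \<Rightarrow> ('g gclass + 'g gclass) zpoly" where
  "witt_prod G \<tau> = (THE M. M \<in> extensional (gclasses G \<tau>) \<and>
     (\<forall>T\<in>gclasses G \<tau>.
        witt_poly G \<tau> T (\<lambda>U. zvar (Inl U)) * witt_poly G \<tau> T (\<lambda>U. zvar (Inr U)) =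
        witt_poly G \<tau> T M))"


section \<open>The Witt--Burnside ring\<close>

text \<open>
  The neutral elements are determined by the two operations: the Witt polynomials all take the
  value 0 at the zero family, and all take the value 1 at the family which is 1 at the one-point
  G-set and 0 elsewhere.
\<close>

definition witt_burnside_ring ::
  "('g, 'z) monoid_scheme \<Rightarrow> 'g topology \<Rightarrow> 'a itself \<Rightarrow> ('g gclass \<Rightarrow> 'a::comm_ring_1) ring" where
  "witt_burnside_ring G \<tau> A =
     \<lparr>carrier = gclasses G \<tau> \<rightarrow>\<^sub>E UNIV,
      monoid.mult = (\<lambda>a b. \<lambda>T\<in>gclasses G \<tau>. zeval (case_sum a b) (witt_prod G \<tau> T)),
      one = (\<lambda>T\<in>gclasses G \<tau>. if gcard T = 1 then 1 else 0),
      zero = (\<lambda>T\<in>gclasses G \<tau>. 0),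
      add = (\<lambda>a b. \<lambda>T\<in>gclasses G \<tau>. zeval (case_sum a b) (witt_sum G \<tau> T))\<rparr>"

definition zero_divisor :: "('r, 'z) ring_scheme \<Rightarrow> 'r \<Rightarrow> bool" where
  "zero_divisor R a \<longleftrightarrow>
     (\<exists>b\<in>carrier R. b \<noteq> \<zero>\<^bsub>R\<^esub> \<and> (a \<otimes>\<^bsub>R\<^esub> b = \<zero>\<^bsub>R\<^esub> \<or> b \<otimes>\<^bsub>R\<^esub> a = \<zero>\<^bsub>R\<^esub>))"


section \<open>The profinite group of pairs of p-adic integers\<close>

text \<open>
  The additive group of p-adic integers as the inverse limit of the groups of integers modulo
  \<open>p ^ n\<close>, residues being represented by \<open>0, \<dots>, p ^ n - 1\<close>; its topology is induced by the
  product of the discrete topologies.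
\<close>

definition Zp :: "nat \<Rightarrow> (nat \<Rightarrow> int) monoid" where
  "Zp p =
     \<lparr>carrier = {x. \<forall>n. 0 \<le> x n \<and> x n < int p ^ n \<and> x (Suc n) mod int p ^ n = x n},
      monoid.mult = (\<lambda>x y n. (x n + y n) mod int p ^ n),
      one = (\<lambda>n. 0)\<rparr>"

definition Zp_topology :: "nat \<Rightarrow> (nat \<Rightarrow> int) topology" where
  "Zp_topology p =
     subtopology (product_topology (\<lambda>n. discrete_topology UNIV) UNIV) (carrier (Zp p))"

definition Zp2 :: "nat \<Rightarrow> ((nat \<Rightarrow> int) \<times> (nat \<Rightarrow> int)) monoid" where
  "Zp2 p = Zp p \<times>\<times> Zp p"

definition Zp2_topology :: "nat \<Rightarrow> ((nat \<Rightarrow> int) \<times> (nat \<Rightarrow> int)) topology" where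
  "Zp2_topology p = prod_topology (Zp_topology p) (Zp_topology p)"

end

theory Submission
  imports Defs
begin

text \<open>
  The proof compares a Witt vector with its ghost components, the values of the Witt polynomials.

  A transitive finite set of \<open>G = \<int>\<^sub>p\<^sup>2\<close> is already transitive under the dense subgroup
  \<open>\<int>\<^sup>2\<close>, and it is determined up to isomorphism by its stabilizer there, a subgroup of \<open>\<int>\<^sup>2\<close>
  which contains some \<open>p\<^sup>N\<int>\<^sup>2\<close>. All such subgroups occur (\<open>bij_betw_lat\<close>), so that the Witt
  polynomials are indexed by these subgroups, \<open>U \<le> T\<close> means that the stabilizer of \<open>T\<close> is
  contained in that of \<open>U\<close>, and cardinalities are indices (\<open>witt_poly_eq_plane_witt\<close>).

  The polynomials \<open>S\<^sub>T\<close> and \<open>M\<^sub>T\<close> are unique since ghost components determine a family of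
  polynomials over the integers. They exist because of a criterion in the style of Dwork's lemma:
  a family \<open>w\<close> of polynomials consists of the ghost components of a family of polynomials if and
  only if, for every subgroup \<open>H\<close>, the sum over \<open>g\<close> in \<open>\<int>\<^sup>2 / H\<close> of \<open>w\<close> at the subgroup
  generated by \<open>H\<close> and \<open>g\<close>, twisted by a power of the Frobenius lift \<open>X \<mapsto> X\<^sup>p\<close>, is divisible by
  the index of \<open>H\<close>. For integers without the twist this is the Cauchy--Frobenius count of orbits
  (\<open>burnside_cong_plane_witt\<close> and \<open>burnside_cong_imp_plane_witt\<close>). The congruences are additive,
  and the products of the ghost components of two families of variables satisfy them
  (\<open>burnside_cong_plane_witt_zvar_mult\<close>).

  Now let \<open>b\<close> be a nonzero Witt vector over \<open>k\<close> which is killed by \<open>p\<close>, and let \<open>n\<close> be the least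
  cardinality of a \<open>T\<close> with \<open>b\<^sub>T \<noteq> 0\<close>. Lift \<open>b\<close> to a family \<open>x\<close> of variables, with 0 in place of
  the variables at cardinalities below \<open>n\<close>. The family with ghost components \<open>p W\<^sub>T(x)\<close> is 0 below
  \<open>n\<close>, is \<open>p x\<close> at \<open>n\<close>, and modulo \<open>p\<close> its value at an \<open>M\<close> of cardinality \<open>p n\<close> is the sum of
  \<open>x\<^sub>K\<^sup>p\<close> over all \<open>K \<le> M\<close> of cardinality \<open>n\<close> (\<open>p_multiple_mod_p\<close>). Hence all these sums vanish
  at \<open>b\<close>. This linear system in the \<open>b\<^sub>K\<^sup>p\<close> is triangular. A subgroup \<open>L\<close> of
  index \<open>n\<close> has a basis \<open>(p\<^sup>a, c)\<close>, \<open>(0, p\<^sup>d)\<close>. Let \<open>M\<close> be generated by \<open>(p\<^sup>a, c)\<close> and \<open>(0, p\<^sup>d\<^sup>+\<^sup>1)\<close>.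
  A subgroup of index \<open>n\<close> which contains \<open>M\<close> and differs from \<open>L\<close> has a larger projection to the
  first coordinate (\<open>triangular_sublattice\<close>). So induction on \<open>a\<close> gives \<open>b\<^sub>L = 0\<close> for all \<open>L\<close> of
  index \<open>n\<close> (\<open>vanish_of_upper_sums\<close>), a contradiction.
\<close>

section \<open>Integer polynomials in arbitrarily many variables\<close>

locale unital_ring_map =
  fixes h :: "'a::comm_ring_1 \<Rightarrow> 'b::comm_ring_1"
  assumes map_one: "h 1 = 1"
    and map_add: "h (x + y) = h x + h y"
    and map_mult: "h (x * y) = h x * h y"
begin

lemma map_zero: "h 0 = 0"
  using map_add[of 0 0] by simp

lemma map_uminus: "h (- x) = - h x"
  using map_add[of x "- x"] by (simp add: map_zero add_eq_0_iff)

lemma map_diff: "h (x - y) = h x - h y"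
  using map_add[of x "- y"] by (simp add: map_uminus)

lemma map_of_nat: "h (of_nat n) = of_nat n"
  by (induction n) (simp_all add: map_zero map_one map_add)

lemma map_of_int: "h (of_int n) = of_int n"
  by (cases n rule: int_cases2) (simp_all add: map_of_nat map_uminus)

lemma map_power: "h (x ^ n) = h x ^ n"
  by (induction n) (simp_all add: map_one map_mult)

lemma map_sum: "h (sum f A) = (\<Sum>x\<in>A. h (f x))"
  by (induction A rule: infinite_finite_induct) (simp_all add: map_zero map_add)

lemma map_prod: "h (prod f A) = (\<Prod>x\<in>A. h (f x))"
  by (induction A rule: infinite_finite_induct) (simp_all add: map_one map_mult)

lemma map_zeval: "h (zeval a P) = zeval (\<lambda>v. h (a v)) P"
  by (simp add: zeval_def map_sum map_prod map_mult map_power map_of_int)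

end

lemma unital_ring_map_of_int: "unital_ring_map of_int"
  by standard simp_all

definition monomial_value :: "('v \<Rightarrow> 'r::comm_ring_1) \<Rightarrow> ('v \<Rightarrow>\<^sub>0 nat) \<Rightarrow> 'r" where
  "monomial_value a m = (\<Prod>v\<in>Poly_Mapping.keys m. a v ^ Poly_Mapping.lookup m v)"

lemma monomial_value_superset:
  assumes "finite A" "Poly_Mapping.keys m \<subseteq> A"
  shows "monomial_value a m = (\<Prod>v\<in>A. a v ^ Poly_Mapping.lookup m v)"
  unfolding monomial_value_def using assms
  by (intro prod.mono_neutral_left) (auto simp: in_keys_iff)

lemma monomial_value_add: "monomial_value a (m + n) = monomial_value a m * monomial_value a n"
proof -
  let ?A = "Poly_Mapping.keys m \<union> Poly_Mapping.keys n"
  have fin: "finite ?A" by simp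
  have "monomial_value a (m + n) = (\<Prod>v\<in>?A. a v ^ Poly_Mapping.lookup (m + n) v)"
    by (rule monomial_value_superset[OF fin Poly_Mapping.keys_add])
  also have "\<dots> = monomial_value a m * monomial_value a n"
    by (simp add: monomial_value_superset[OF fin] lookup_add power_add prod.distrib)
  finally show ?thesis .
qed

lemma zeval_superset:
  assumes "finite A" "Poly_Mapping.keys P \<subseteq> A"
  shows "zeval a P = (\<Sum>m\<in>A. of_int (Poly_Mapping.lookup P m) * monomial_value a m)"
  unfolding zeval_def monomial_value_def using assms
  by (intro sum.mono_neutral_left) (auto simp: in_keys_iff)

lemma zeval_single: "zeval a (Poly_Mapping.single m c) = of_int c * monomial_value a m"
  by (cases "c = 0") (simp_all add: zeval_def monomial_value_def)

lemma zeval_add: "zeval a (P + Q) = zeval a P + zeval a Q"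
proof -
  let ?A = "Poly_Mapping.keys P \<union> Poly_Mapping.keys Q"
  have fin: "finite ?A" by simp
  have "zeval a (P + Q) =
      (\<Sum>m\<in>?A. of_int (Poly_Mapping.lookup (P + Q) m) * monomial_value a m)"
    by (rule zeval_superset[OF fin Poly_Mapping.keys_add])
  also have "\<dots> = zeval a P + zeval a Q"
    by (simp add: zeval_superset[OF fin] lookup_add distrib_right sum.distrib)
  finally show ?thesis .
qed

lemma zeval_sum: "zeval a (sum f A) = (\<Sum>x\<in>A. zeval a (f x))"
proof -
  have "zeval a 0 = 0" by (simp add: zeval_def)
  then show ?thesis
    by (induction A rule: infinite_finite_induct) (simp_all add: zeval_add)
qed

text \<open>
  Multiplicativity of evaluation and all statements about \<open>zeval\<close> that are proved by linearity
  reduce to monomials through this decomposition.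
\<close>

lemma zpoly_expand:
  "P = (\<Sum>m\<in>Poly_Mapping.keys P. Poly_Mapping.single m (Poly_Mapping.lookup P m))"
proof (rule poly_mapping_eqI)
  fix k
  show "Poly_Mapping.lookup P k = Poly_Mapping.lookup
    (\<Sum>m\<in>Poly_Mapping.keys P. Poly_Mapping.single m (Poly_Mapping.lookup P m)) k"
    by (simp add: lookup_sum lookup_single when_def in_keys_iff)
qed

lemma unital_ring_map_zeval:
  fixes a :: "'v \<Rightarrow> 'r::comm_ring_1"
  shows "unital_ring_map (zeval a)"
proof
  show "zeval a 1 = 1"
    unfolding single_one[symmetric] zeval_single by (simp add: monomial_value_def)
  fix P Q :: "'v zpoly"
  show "zeval a (P + Q) = zeval a P + zeval a Q" by (rule zeval_add)
  let ?s = "\<lambda>P m. Poly_Mapping.single m (Poly_Mapping.lookup P m)"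
  have *: "zeval a P = (\<Sum>m\<in>Poly_Mapping.keys P. zeval a (?s P m))" for P
    by (subst zpoly_expand) (rule zeval_sum)
  have "P * Q = (\<Sum>m\<in>Poly_Mapping.keys P. \<Sum>n\<in>Poly_Mapping.keys Q. ?s P m * ?s Q n)"
    by (subst zpoly_expand[of P], subst zpoly_expand[of Q]) (rule sum_product)
  also have "zeval a \<dots> =
      (\<Sum>m\<in>Poly_Mapping.keys P. \<Sum>n\<in>Poly_Mapping.keys Q. zeval a (?s P m) * zeval a (?s Q n))"
    by (simp add: zeval_sum mult_single zeval_single monomial_value_add mult_ac)
  also have "\<dots> = zeval a P * zeval a Q"
    by (simp only: *[of P] *[of Q] sum_product)
  finally show "zeval a (P * Q) = zeval a P * zeval a Q" .
qed

lemma zeval_zvar: "zeval a (zvar v) = a v"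
  unfolding zvar_def zeval_single by (simp add: monomial_value_def)

lemma zvar_power:
  "zvar v ^ n = (Poly_Mapping.single (Poly_Mapping.single v n) 1 :: 'v zpoly)"
  by (induction n) (simp_all add: zvar_def mult_single flip: single_add)

text \<open>
  Every polynomial is obtained from integers and variables by the ring operations; a property which
  these operations preserve may therefore be checked on \<open>zeval zvar P\<close>.
\<close>

lemma zeval_zvar_id:
  fixes P :: "'v zpoly"
  shows "zeval zvar P = P"
proof -
  have "monomial_value zvar m = (Poly_Mapping.single m 1 :: 'v zpoly)" for m :: "'v \<Rightarrow>\<^sub>0 nat"
  proof -
    have "(\<Prod>v\<in>A. Poly_Mapping.single (Poly_Mapping.single v (f v)) 1 :: 'v zpoly) =
        Poly_Mapping.single (\<Sum>v\<in>A. Poly_Mapping.single v (f v)) 1"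
      if "finite A" for A :: "'v set" and f :: "'v \<Rightarrow> nat"
      using that by (induction A rule: finite_induct) (simp_all add: mult_single)
    moreover have "(\<Sum>v\<in>Poly_Mapping.keys m. Poly_Mapping.single v (Poly_Mapping.lookup m v)) = m"
      by (rule poly_mapping_eqI) (simp add: lookup_sum lookup_single when_def in_keys_iff)
    ultimately show ?thesis by (simp add: monomial_value_def zvar_power)
  qed
  then have "zeval zvar P =
      (\<Sum>m\<in>Poly_Mapping.keys P. of_int (Poly_Mapping.lookup P m) * Poly_Mapping.single m 1)"
    by (simp add: zeval_superset[OF _ order_refl])
  also have "\<dots> = (\<Sum>m\<in>Poly_Mapping.keys P. Poly_Mapping.single m (Poly_Mapping.lookup P m))"
    unfolding single_of_int[symmetric] mult_single by simp
  also have "\<dots> = P" by (rule zpoly_expand[symmetric])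
  finally show ?thesis .
qed

lemma lookup_of_nat_mult:
  "Poly_Mapping.lookup (of_nat n * P :: 'v zpoly) m = of_nat n * Poly_Mapping.lookup P m"
  by (induction n) (simp_all add: lookup_add distrib_right)

text \<open>
  Ghost components are divided by indices, which needs that the polynomial ring is torsion-free.
\<close>

lemma of_nat_mult_cancel:
  fixes P Q :: "'v zpoly"
  assumes "of_nat n * P = of_nat n * Q" "n > 0"
  shows "P = Q"
proof (rule poly_mapping_eqI)
  fix m
  have "Poly_Mapping.lookup (of_nat n * P) m = Poly_Mapping.lookup (of_nat n * Q) m"
    using assms by simp
  then show "Poly_Mapping.lookup P m = Poly_Mapping.lookup Q m"
    using assms(2) by (simp only: lookup_of_nat_mult) simp
qed

section \<open>Congruences modulo powers of a prime\<close>

lemma prime_dvd_add_power_diff: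
  fixes x y :: "'r::comm_ring_1"
  assumes p: "prime p"
  shows "of_nat p dvd (x + y) ^ p - (x ^ p + y ^ p)"
proof -
  let ?f = "\<lambda>k. of_nat (p choose k) * x ^ k * y ^ (p - k)"
  have split: "{..p} = insert 0 (insert p {1..<p})" and "0 \<noteq> p"
    using prime_gt_0_nat[OF p] by auto
  have "(x + y) ^ p - (x ^ p + y ^ p) = (\<Sum>k\<in>{1..<p}. ?f k)"
    unfolding binomial_ring split using \<open>0 \<noteq> p\<close> by simp
  moreover have "of_nat p dvd ?f k" if "k \<in> {1..<p}" for k
  proof -
    have "p dvd (p choose k)" using that p by (intro dvd_choose_prime) auto
    then have "of_nat p dvd (of_nat (p choose k) :: 'r)" by (auto elim!: dvdE)
    then show ?thesis by (simp add: mult.assoc)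
  qed
  ultimately show ?thesis by (auto intro: dvd_sum)
qed

lemma dvd_power_diff:
  fixes x y :: "'r::comm_ring_1"
  assumes "d dvd x - y"
  shows "d dvd x ^ n - y ^ n"
  using assms by (cases n) (simp_all add: diff_power_eq_sum del: power_Suc)

text \<open>
  Each further \<open>p\<close>-th power gains one factor \<open>p\<close>, since the cofactor of \<open>a - b\<close> in
  \<open>a ^ p - b ^ p\<close> is a sum of \<open>p\<close> terms which are congruent to one another.
\<close>

lemma dvd_prime_power_diff:
  fixes x y :: "'r::comm_ring_1"
  assumes "of_nat p dvd x - y"
  shows "of_nat (p ^ Suc i) dvd x ^ (p ^ i) - y ^ (p ^ i)"
proof (induction i)
  case 0
  then show ?case using assms by simp
next
  case (Suc i)
  show ?case
  proof (cases p)
    case 0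
    then show ?thesis using assms by simp
  next
    case (Suc q)
    define a where "a = x ^ (p ^ i)"
    define b where "b = y ^ (p ^ i)"
    have ab: "of_nat p dvd a - b"
      unfolding a_def b_def using assms by (rule dvd_power_diff)
    \<comment> \<open>All \<open>p\<close> summands of the cofactor of \<open>a - b\<close> are congruent to \<open>b ^ q\<close>.\<close>
    have "(\<Sum>k<Suc q. a ^ k * b ^ (q - k)) - of_nat p * b ^ q =
        (\<Sum>k<Suc q. (a ^ k - b ^ k) * b ^ (q - k))"
      by (simp add: Suc left_diff_distrib sum_subtractf del: sum.lessThan_Suc flip: power_add)
    moreover have "of_nat p dvd \<dots>"
      using ab by (intro dvd_sum dvd_mult2 dvd_power_diff)
    ultimately have "of_nat p dvd (\<Sum>k<Suc q. a ^ k * b ^ (q - k)) - of_nat p * b ^ q"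
      by (simp only:)
    then have "of_nat p dvd (\<Sum>k<Suc q. a ^ k * b ^ (q - k))"
      by (metis dvd_triv_left dvd_diff_commute dvd_add_right_iff diff_add_cancel)
    then have "of_nat (p ^ Suc i) * of_nat p dvd (a - b) * (\<Sum>k<Suc q. a ^ k * b ^ (q - k))"
      using Suc.IH unfolding a_def b_def by (intro mult_dvd_mono)
    also have "(a - b) * (\<Sum>k<Suc q. a ^ k * b ^ (q - k)) = a ^ p - b ^ p"
      using diff_power_eq_sum[of a q b] by (simp add: Suc mult.commute)
    finally show ?thesis by (simp add: a_def b_def power_mult[symmetric] mult_ac)
  qed
qed

text \<open>
  The lift \<open>X \<mapsto> X ^ p\<close> of the Frobenius endomorphism from characteristic \<open>p\<close> to integer polynomials.
\<close>

definition frob :: "nat \<Rightarrow> 'v zpoly \<Rightarrow> 'v zpoly" where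
  "frob p = zeval (\<lambda>v. zvar v ^ p)"

lemma unital_ring_map_frob: "unital_ring_map (frob p)"
  unfolding frob_def by (rule unital_ring_map_zeval)

lemma unital_ring_map_frob_pow:
  "unital_ring_map (frob p ^^ k :: 'v zpoly \<Rightarrow> 'v zpoly)"
proof (induction k)
  case 0
  show ?case by standard simp_all
next
  case (Suc k)
  interpret a: unital_ring_map "frob p :: 'v zpoly \<Rightarrow> 'v zpoly" by (rule unital_ring_map_frob)
  interpret b: unital_ring_map "frob p ^^ k :: 'v zpoly \<Rightarrow> 'v zpoly" by (rule Suc)
  show ?case
    by standard (simp_all add: a.map_one a.map_add a.map_mult b.map_one b.map_add b.map_mult)
qed

lemma frob_pow_zvar: "(frob p ^^ k) (zvar v :: 'v zpoly) = zvar v ^ (p ^ k)"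
proof (induction k)
  case (Suc k)
  interpret a: unital_ring_map "frob p :: 'v zpoly \<Rightarrow> 'v zpoly" by (rule unital_ring_map_frob)
  have "frob p (zvar v :: 'v zpoly) = zvar v ^ p" by (simp add: frob_def zeval_zvar)
  then show ?case by (simp add: Suc a.map_power power_mult[symmetric] mult.commute)
qed simp

text \<open>
  Both sides agree on variables and, up to multiples of \<open>p\<close>, both are compatible with sums and
  products; the integer constants are reached from 1 and -1.
\<close>

lemma frob_cong_power:
  fixes P :: "'v zpoly"
  assumes p: "prime p"
  shows "of_nat p dvd frob p P - P ^ p"
proof -
  interpret a: unital_ring_map "frob p :: 'v zpoly \<Rightarrow> 'v zpoly" by (rule unital_ring_map_frob)
  define C where "C = {P :: 'v zpoly. of_nat p dvd frob p P - P ^ p}"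
  have add: "P + Q \<in> C" if "P \<in> C" "Q \<in> C" for P Q
  proof -
    have "frob p (P + Q) - (P + Q) ^ p =
        (frob p P - P ^ p) + (frob p Q - Q ^ p) - ((P + Q) ^ p - (P ^ p + Q ^ p))"
      by (simp add: a.map_add)
    moreover have "of_nat p dvd (frob p P - P ^ p) + (frob p Q - Q ^ p)"
      using that unfolding C_def mem_Collect_eq by (rule dvd_add)
    ultimately show ?thesis
      using prime_dvd_add_power_diff[OF p, of P Q] unfolding C_def mem_Collect_eq
      by (simp only: dvd_diff)
  qed
  have mult: "P * Q \<in> C" if "P \<in> C" "Q \<in> C" for P Q
  proof -
    have "frob p (P * Q) - (P * Q) ^ p =
        (frob p P - P ^ p) * frob p Q + P ^ p * (frob p Q - Q ^ p)"
      by (simp add: a.map_mult power_mult_distrib algebra_simps)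
    moreover have "of_nat p dvd (frob p P - P ^ p) * frob p Q"
      using that unfolding C_def mem_Collect_eq by (intro dvd_mult2)
    moreover have "of_nat p dvd P ^ p * (frob p Q - Q ^ p)"
      using that unfolding C_def mem_Collect_eq by (intro dvd_mult)
    ultimately show ?thesis
      unfolding C_def mem_Collect_eq by (simp only: dvd_add)
  qed
  have one: "1 \<in> C" by (simp add: C_def a.map_one)
  have zero: "0 \<in> C" using prime_gt_0_nat[OF p] by (simp add: C_def a.map_zero power_0_left)
  have minus: "- 1 \<in> C"
  proof (cases "p = 2")
    case True
    have "frob p (- 1 :: 'v zpoly) = - 1" by (simp add: a.map_uminus a.map_one)
    then show ?thesis using True by (simp add: C_def)
  next
    case False
    then have "odd p" using p primes_dvd_imp_eq two_is_prime_nat by blast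
    then show ?thesis by (simp add: C_def a.map_uminus a.map_one)
  qed
  have nat: "of_nat n \<in> C" for n
    by (induction n) (simp_all add: zero one add)
  have int: "of_int n \<in> C" for n
    using nat mult[OF minus nat] by (cases n rule: int_cases2) simp_all
  have var: "zvar v \<in> C" for v
    by (simp add: C_def frob_def zeval_zvar)
  have power: "P ^ n \<in> C" if "P \<in> C" for P n
    using that by (induction n) (simp_all add: one mult)
  have sum: "sum f A \<in> C" if "\<And>x. x \<in> A \<Longrightarrow> f x \<in> C" for f :: "'i \<Rightarrow> 'v zpoly" and A
    using that by (induction A rule: infinite_finite_induct) (simp_all add: zero add)
  have prod: "prod f A \<in> C" if "\<And>x. x \<in> A \<Longrightarrow> f x \<in> C" for f :: "'i \<Rightarrow> 'v zpoly" and A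
    using that by (induction A rule: infinite_finite_induct) (simp_all add: one mult)
  have "zeval zvar P \<in> C"
    unfolding zeval_def by (intro sum mult int prod power var)
  then show ?thesis by (simp add: zeval_zvar_id C_def)
qed

section \<open>Subgroups of the integer plane of p-power index\<close>

definition scale :: "int \<Rightarrow> int \<times> int \<Rightarrow> int \<times> int" where
  "scale n x = (n * fst x, n * snd x)"

lemma scale_simps:
  "scale n (x + y) = scale n x + scale n y"
  "scale n (x - y) = scale n x - scale n y"
  "scale (m + n) x = scale m x + scale n x"
  "scale (m - n) x = scale m x - scale n x"
  "scale m (scale n x) = scale (m * n) x"
  "scale 1 x = x"
  "scale 0 x = 0"
  "scale n 0 = 0"
  by (simp_all add: scale_def prod_eq_iff algebra_simps)

type_synonym Zp2_set = "((nat \<Rightarrow> int) \<times> (nat \<Rightarrow> int)) gset"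
type_synonym Zp2_class = "((nat \<Rightarrow> int) \<times> (nat \<Rightarrow> int)) gclass"

locale prime_index =
  fixes p :: nat
  assumes prime_p: "prime p"
begin

lemma p_gt_1: "p > 1"
  using prime_p by (rule prime_gt_1_nat)

lemma p_gt_0: "p > 0"
  using p_gt_1 by simp

text \<open>
  The gcd of an element of the ideal and the given power of \<open>p\<close> is a power of \<open>p\<close> in the ideal.
  The lemma describes the orders of elements modulo a subgroup and the two projections of a
  subgroup of the plane.
\<close>

lemma ideal_eq_multiples:
  fixes I :: "int set"
  assumes zero: "0 \<in> I" and diff: "\<And>x y. x \<in> I \<Longrightarrow> y \<in> I \<Longrightarrow> x - y \<in> I"
    and pow: "int p ^ N \<in> I"
  shows "I = {i. int p ^ (LEAST c. int p ^ c \<in> I) dvd i}"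
proof -
  define c where "c = (LEAST c. int p ^ c \<in> I)"
  have c: "int p ^ c \<in> I"
    unfolding c_def using pow by (rule LeastI)
  have add: "x + y \<in> I" if "x \<in> I" "y \<in> I" for x y
    using diff[OF that(1) diff[OF zero that(2)]] by simp
  have mult: "n * x \<in> I" if "x \<in> I" for n x
  proof (induction n rule: int_induct[where k = 0])
    case base
    show ?case using zero by simp
  next
    case (step1 i)
    then show ?case using add[of "i * x" x] that by (simp add: distrib_right)
  next
    case (step2 i)
    then show ?case using diff[of "i * x" x] that by (simp add: left_diff_distrib)
  qed
  have "int p ^ c dvd i" if i: "i \<in> I" for i
  proof -
    define d where "d = gcd i (int p ^ N)"
    obtain u v where "u * i + v * int p ^ N = d"
      unfolding d_def using bezout_int by blast
    then have d: "d \<in> I" using add[OF mult[OF i] mult[OF pow]] by metis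
    have "d dvd int (p ^ N)" "d \<ge> 0" by (simp_all add: d_def)
    then have "nat d dvd p ^ N" by (simp add: nat_dvd_iff)
    then obtain l where "nat d = p ^ l"
      using prime_p divides_primepow_nat by blast
    then have l: "d = int p ^ l" using \<open>d \<ge> 0\<close> by (metis nat_0_le of_nat_power)
    then have "c \<le> l" using d unfolding c_def by (auto intro: Least_le)
    then have "int p ^ c dvd d" unfolding l by (rule le_imp_power_dvd)
    also have "d dvd i" by (simp add: d_def)
    finally show ?thesis .
  qed
  moreover have "i \<in> I" if "int p ^ c dvd i" for i
    using that mult[OF c] by (auto simp: mult.commute elim!: dvdE)
  ultimately show ?thesis unfolding c_def by blast
qed

definition has_level :: "(int \<times> int) set \<Rightarrow> nat \<Rightarrow> bool" where
  "has_level L N \<longleftrightarrow> (\<forall>x. scale (int p ^ N) x \<in> L)"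

text \<open>
  The traces on \<open>\<int>\<^sup>2\<close> of the open subgroups of \<open>\<int>\<^sub>p\<^sup>2\<close>.
\<close>

definition Lat :: "(int \<times> int) set set" where
  "Lat = {L. 0 \<in> L \<and> (\<forall>x\<in>L. \<forall>y\<in>L. x - y \<in> L) \<and> (\<exists>N. has_level L N)}"

lemma LatI:
  assumes "0 \<in> L" "\<And>x y. x \<in> L \<Longrightarrow> y \<in> L \<Longrightarrow> x - y \<in> L" "has_level L N"
  shows "L \<in> Lat"
  using assms by (auto simp: Lat_def)

context
  fixes L assumes L: "L \<in> Lat"
begin

lemma Lat_zero: "0 \<in> L"
  using L by (simp add: Lat_def)

lemma Lat_diff: "x \<in> L \<Longrightarrow> y \<in> L \<Longrightarrow> x - y \<in> L"
  using L by (simp add: Lat_def)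

lemma Lat_add: "x \<in> L \<Longrightarrow> y \<in> L \<Longrightarrow> x + y \<in> L"
  using Lat_diff[of x "0 - y"] Lat_diff[of 0 y] Lat_zero by simp

lemma Lat_level: "\<exists>N. has_level L N"
  using L by (simp add: Lat_def)

lemma Lat_scale: "x \<in> L \<Longrightarrow> scale n x \<in> L"
proof (induction n rule: int_induct[where k = 0])
  case base
  show ?case using Lat_zero by (simp add: scale_simps)
next
  case (step1 i)
  then show ?case using Lat_add[of "scale i x" x] by (simp add: scale_simps)
next
  case (step2 i)
  then show ?case using Lat_diff[of "scale i x" x] by (simp add: scale_simps)
qed

lemma Lat_add_iff: "y \<in> L \<Longrightarrow> x + y \<in> L \<longleftrightarrow> x \<in> L"
  using Lat_add[of x y] Lat_diff[of "x + y" y] by auto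

lemma Lat_diff_iff: "y \<in> L \<Longrightarrow> x - y \<in> L \<longleftrightarrow> x \<in> L"
  using Lat_diff[of x y] Lat_add[of "x - y" y] by auto

end

lemma has_level_mono: "has_level L N \<Longrightarrow> L \<in> Lat \<Longrightarrow> N \<le> M \<Longrightarrow> has_level L M"
  unfolding has_level_def
proof
  fix x assume "\<forall>x. scale (int p ^ N) x \<in> L" "N \<le> M"
  then have "scale (int p ^ N) (scale (int p ^ (M - N)) x) \<in> L" by blast
  then show "scale (int p ^ M) x \<in> L"
    using \<open>N \<le> M\<close> by (simp add: scale_simps flip: power_add)
qed

lemma has_level_supset: "has_level H N \<Longrightarrow> H \<subseteq> L \<Longrightarrow> has_level L N"
  by (auto simp: has_level_def)

text \<open>
  Representatives of \<open>\<int>\<^sup>2\<close> modulo \<open>p\<^sup>N\<close>. Sums over the quotient by a subgroup of level \<open>N\<close> are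
  replaced by sums over this box, in which every coset occurs equally often; this avoids quotient
  groups.
\<close>

definition box :: "nat \<Rightarrow> (int \<times> int) set" where
  "box N = {0..<int p ^ N} \<times> {0..<int p ^ N}"

definition reduce :: "nat \<Rightarrow> int \<times> int \<Rightarrow> int \<times> int" where
  "reduce N x = (fst x mod int p ^ N, snd x mod int p ^ N)"

lemma finite_box: "finite (box N)"
  by (simp add: box_def)

lemma card_box: "card (box N) = p ^ (2 * N)"
  by (simp add: box_def card_cartesian_product mult_2 power_add flip: of_nat_power)

lemma reduce_in_box: "reduce N x \<in> box N"
  using p_gt_0 by (simp add: reduce_def box_def)

lemma reduce_id: "x \<in> box N \<Longrightarrow> reduce N x = x"
  by (auto simp: reduce_def box_def)

lemma reduce_eq: "reduce N x = x - scale (int p ^ N) (fst x div int p ^ N, snd x div int p ^ N)"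
  by (simp add: reduce_def scale_def prod_eq_iff minus_mult_div_eq_mod)

lemma reduce_diff_left: "reduce N (reduce N x - y) = reduce N (x - y)"
  by (simp add: reduce_def mod_diff_left_eq)

lemma reduce_add_left: "reduce N (reduce N x + y) = reduce N (x + y)"
  by (simp add: reduce_def mod_add_left_eq)

lemma reduce_mem_iff:
  assumes "L \<in> Lat" "has_level L N"
  shows "reduce N x \<in> L \<longleftrightarrow> x \<in> L"
  unfolding reduce_eq using assms by (intro Lat_diff_iff) (auto simp: has_level_def)

definition coset :: "(int \<times> int) set \<Rightarrow> int \<times> int \<Rightarrow> (int \<times> int) set" where
  "coset L x = {y. y - x \<in> L}"

definition idx :: "(int \<times> int) set \<Rightarrow> nat" where
  "idx L = card (range (coset L))"

lemma coset_eq_iff: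
  assumes "L \<in> Lat"
  shows "coset L x = coset L y \<longleftrightarrow> x - y \<in> L"
proof
  assume "coset L x = coset L y"
  moreover have "x \<in> coset L x" by (simp add: coset_def Lat_zero[OF assms])
  ultimately show "x - y \<in> L" by (simp add: coset_def)
next
  assume *: "x - y \<in> L"
  have "z - y \<in> L \<longleftrightarrow> z - x \<in> L" for z
    using Lat_add_iff[OF assms *, of "z - x"] by simp
  then show "coset L x = coset L y" by (auto simp: coset_def)
qed

lemma card_box_coset:
  assumes L: "L \<in> Lat" "has_level L N"
  shows "card {y \<in> box N. y - x \<in> L} = card (box N \<inter> L)"
proof (rule bij_betw_same_card)
  show "bij_betw (\<lambda>y. reduce N (y - x)) {y \<in> box N. y - x \<in> L} (box N \<inter> L)"
  proof (rule bij_betw_byWitness[where f' = "\<lambda>y. reduce N (y + x)"])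
    show "\<forall>y\<in>{y \<in> box N. y - x \<in> L}. reduce N (reduce N (y - x) + x) = y"
      by (simp add: reduce_add_left reduce_id)
    show "\<forall>y\<in>box N \<inter> L. reduce N (reduce N (y + x) - x) = y"
      by (simp add: reduce_diff_left reduce_id)
    show "(\<lambda>y. reduce N (y - x)) ` {y \<in> box N. y - x \<in> L} \<subseteq> box N \<inter> L"
      using L by (auto simp: reduce_in_box reduce_mem_iff)
    have "reduce N (y + x) - x \<in> L" if "y \<in> L" for y
      using that reduce_mem_iff[OF L, of "reduce N (y + x) - x"] reduce_mem_iff[OF L, of y]
      by (simp add: reduce_diff_left)
    then show "(\<lambda>y. reduce N (y + x)) ` (box N \<inter> L) \<subseteq> {y \<in> box N. y - x \<in> L}"
      by (auto simp: reduce_in_box)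
  qed
qed

lemma range_coset:
  assumes L: "L \<in> Lat" "has_level L N"
  shows "range (coset L) = coset L ` box N"
proof -
  have "coset L x = coset L (reduce N x)" for x
    using L by (simp add: coset_eq_iff reduce_eq has_level_def)
  then show ?thesis using reduce_in_box by blast
qed

text \<open>
  The box splits into the cosets of \<open>L\<close>, all of which meet it in equally many points. This
  turns inclusions of subgroups into inequalities between their indices.
\<close>

lemma card_box_Lat:
  assumes L: "L \<in> Lat" "has_level L N"
  shows "card (box N \<inter> L) * idx L = p ^ (2 * N)"
proof -
  have "card {y \<in> box N. coset L y = C} = card (box N \<inter> L)" if C: "C \<in> coset L ` box N" for C
    using C card_box_coset[OF L] by (auto simp: coset_eq_iff[OF L(1)])
  moreover have "card (box N) = (\<Sum>C\<in>coset L ` box N. card {y \<in> box N. coset L y = C})"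
    using sum.image_gen[OF finite_box, of "\<lambda>_. 1 :: nat" N "coset L"] by simp
  ultimately show ?thesis
    by (simp add: card_box idx_def range_coset[OF L] mult.commute)
qed

lemma card_box_Lat_pos:
  assumes "L \<in> Lat" "has_level L N"
  shows "card (box N \<inter> L) > 0"
proof -
  have "card (box N \<inter> L) * idx L > 0"
    unfolding card_box_Lat[OF assms] using p_gt_0 by simp
  then show ?thesis by simp
qed

lemma finite_range_coset: "L \<in> Lat \<Longrightarrow> finite (range (coset L))"
  using Lat_level range_coset finite_box by (metis finite_imageI)

lemma idx_pos: "L \<in> Lat \<Longrightarrow> idx L > 0"
  by (simp add: idx_def card_gt_0_iff finite_range_coset)

lemma idx_prime_power:
  assumes "L \<in> Lat"
  obtains a where "idx L = p ^ a"
proof -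
  obtain N where "has_level L N" using Lat_level[OF assms] by blast
  then have "idx L dvd p ^ (2 * N)"
    using card_box_Lat[OF assms] by (metis dvd_triv_right)
  then show ?thesis using divides_primepow_nat[OF prime_p] that by blast
qed

lemma idx_le:
  assumes HL: "H \<in> Lat" "L \<in> Lat" "H \<subseteq> L"
  shows "idx L \<le> idx H" and "H \<noteq> L \<Longrightarrow> idx L < idx H"
proof -
  obtain N where H: "has_level H N" using Lat_level[OF HL(1)] by blast
  then have L: "has_level L N" using HL(3) by (rule has_level_supset)
  have eq: "card (box N \<inter> H) * idx H = card (box N \<inter> L) * idx L"
    using card_box_Lat H L HL by simp
  have pos: "card (box N \<inter> H) > 0" using HL(1) H by (rule card_box_Lat_pos)
  have "card (box N \<inter> H) \<le> card (box N \<inter> L)"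
    using HL(3) finite_box by (intro card_mono) auto
  then have "card (box N \<inter> H) * idx L \<le> card (box N \<inter> L) * idx L"
    by simp
  then show "idx L \<le> idx H"
    unfolding eq[symmetric] using pos by simp
  assume "H \<noteq> L"
  then obtain x where x: "x \<in> L" "x \<notin> H" using HL(3) by blast
  then have "reduce N x \<in> box N \<inter> L" "reduce N x \<notin> box N \<inter> H"
    using HL H L by (simp_all add: reduce_in_box reduce_mem_iff)
  then have "box N \<inter> H \<subset> box N \<inter> L"
    using HL(3) by blast
  then have "card (box N \<inter> H) < card (box N \<inter> L)"
    using finite_box by (intro psubset_card_mono) auto
  then have "card (box N \<inter> H) * idx L < card (box N \<inter> L) * idx L"
    using idx_pos[OF HL(2)] by simp
  then show "idx L < idx H"
    unfolding eq[symmetric] using pos by simp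
qed

lemma idx_less: "H \<in> Lat \<Longrightarrow> L \<in> Lat \<Longrightarrow> H \<subset> L \<Longrightarrow> idx L < idx H"
  by (simp add: idx_le(2) psubset_eq)

lemma idx_div_pos: "H \<in> Lat \<Longrightarrow> L \<in> Lat \<Longrightarrow> H \<subseteq> L \<Longrightarrow> 0 < idx H div idx L"
  using idx_le(1)[of H L] idx_pos[of L] by (simp add: div_greater_zero_iff)

lemma idx_eq_imp_eq:
  "H \<in> Lat \<Longrightarrow> L \<in> Lat \<Longrightarrow> H \<subseteq> L \<Longrightarrow> idx H = idx L \<Longrightarrow> H = L"
  using idx_le(2)[of H L] by auto

lemma prime_power_le_dvd: "p ^ a \<le> p ^ b \<Longrightarrow> p ^ a dvd p ^ b"
  using p_gt_1 by (simp add: le_imp_power_dvd)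

lemma prime_power_less_dvd: "p ^ a < p ^ b \<Longrightarrow> p ^ a * p dvd p ^ b"
  using p_gt_1 le_imp_power_dvd[of "Suc a" b p] by (simp add: mult.commute)

text \<open>
  Indices are powers of \<open>p\<close>, so that divisibility follows from inequalities.
\<close>

lemma idx_dvd:
  assumes "H \<in> Lat" "L \<in> Lat" "H \<subseteq> L"
  shows "idx L dvd idx H" and "H \<noteq> L \<Longrightarrow> idx L * p dvd idx H"
  using idx_le[OF assms] idx_prime_power[OF assms(1)] idx_prime_power[OF assms(2)]
    prime_power_le_dvd prime_power_less_dvd
  by (metis, metis)

lemma idx_quotient:
  assumes "H \<in> Lat" "L \<in> Lat" "H \<subseteq> L"
  obtains m where "idx H = idx L * p ^ m"
proof -
  obtain a b where ab: "idx H = p ^ a" "idx L = p ^ b"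
    using idx_prime_power assms by metis
  then have "b \<le> a" using idx_le(1)[OF assms] p_gt_1 by simp
  then have "idx H = idx L * p ^ (a - b)" by (simp add: ab flip: power_add)
  then show ?thesis by (rule that)
qed

lemma finite_supLat:
  assumes H: "H \<in> Lat"
  shows "finite {L \<in> Lat. H \<subseteq> L}"
proof -
  obtain N where N: "has_level H N" using Lat_level[OF H] by blast
  have "L = {x. reduce N x \<in> box N \<inter> L}" if "L \<in> Lat" "H \<subseteq> L" for L
    using that reduce_mem_iff[OF _ has_level_supset[OF N]] reduce_in_box by auto
  then have "inj_on (\<lambda>L. box N \<inter> L) {L \<in> Lat. H \<subseteq> L}"
    by (intro inj_on_inverseI[where g = "\<lambda>C. {x. reduce N x \<in> C}"]) auto
  moreover have "finite ((\<lambda>L. box N \<inter> L) ` {L \<in> Lat. H \<subseteq> L})"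
    by (rule finite_subset[of _ "Pow (box N)"]) (auto simp: finite_box)
  ultimately show ?thesis by (rule finite_imageD[rotated])
qed

lemma Lat_Int:
  assumes "H \<in> Lat" "L \<in> Lat"
  shows "H \<inter> L \<in> Lat"
proof -
  obtain M N where "has_level H M" "has_level L N"
    using assms Lat_level by blast
  then have "has_level H (max M N)" "has_level L (max M N)"
    using assms by (auto intro: has_level_mono)
  then show ?thesis
    using assms by (intro LatI[where N = "max M N"]) (auto simp: Lat_zero Lat_diff has_level_def)
qed

text \<open>
  A coset of the intersection is the intersection of a coset of \<open>H\<close> and a coset of \<open>L\<close>.
\<close>

lemma idx_Int_dvd:
  assumes "H \<in> Lat" "L \<in> Lat"
  shows "idx (H \<inter> L) dvd idx H * idx L"
proof -
  have "range (coset (H \<inter> L)) = (\<lambda>x. coset H x \<inter> coset L x) ` UNIV"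
    by (auto simp: coset_def)
  also have "\<dots> \<subseteq> (\<lambda>(A, B). A \<inter> B) ` (range (coset H) \<times> range (coset L))"
    by auto
  finally have "idx (H \<inter> L) \<le> card (range (coset H) \<times> range (coset L))"
    unfolding idx_def using assms by (intro surj_card_le) (auto simp: finite_range_coset)
  then have le: "idx (H \<inter> L) \<le> idx H * idx L"
    by (simp add: idx_def card_cartesian_product)
  obtain a b c where "idx (H \<inter> L) = p ^ a" "idx H = p ^ b" "idx L = p ^ c"
    using assms Lat_Int idx_prime_power by metis
  then show ?thesis using le prime_power_le_dvd[of a "b + c"] by (simp add: power_add)
qed

definition adjoin :: "(int \<times> int) set \<Rightarrow> int \<times> int \<Rightarrow> (int \<times> int) set" where
  "adjoin H g = {x. \<exists>i. x - scale i g \<in> H}"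

text \<open>
  The order of \<open>g\<close> modulo \<open>H\<close> is \<open>p ^ ord_exp H g\<close>.
\<close>

definition ord_exp :: "(int \<times> int) set \<Rightarrow> int \<times> int \<Rightarrow> nat" where
  "ord_exp H g = (LEAST c. scale (int p ^ c) g \<in> H)"

context
  fixes H assumes H: "H \<in> Lat"
begin

lemma scale_mem_iff: "scale i g \<in> H \<longleftrightarrow> int p ^ ord_exp H g dvd i"
proof -
  obtain N where N: "has_level H N" using Lat_level[OF H] by blast
  have "{i. scale i g \<in> H} = {i. int p ^ (LEAST c. int p ^ c \<in> {i. scale i g \<in> H}) dvd i}"
    by (rule ideal_eq_multiples[where N = N])
      (use H N[unfolded has_level_def, rule_format, of g] in
        \<open>simp_all add: scale_simps Lat_zero Lat_diff\<close>)
  then show ?thesis unfolding ord_exp_def by auto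
qed

lemma ord_exp_le_iff: "ord_exp H g \<le> j \<longleftrightarrow> scale (int p ^ j) g \<in> H"
proof -
  have "int p ^ a dvd int p ^ b \<longleftrightarrow> a \<le> b" for a b
    using p_gt_1 by (simp add: dvd_power_iff)
  then show ?thesis by (simp add: scale_mem_iff)
qed

lemma adjoin_Lat: "adjoin H g \<in> Lat"
proof -
  obtain N where N: "has_level H N" using Lat_level[OF H] by blast
  show ?thesis
  proof (rule LatI)
    show "0 \<in> adjoin H g"
      unfolding adjoin_def using Lat_zero[OF H]
      by (auto intro!: exI[of _ 0] simp: scale_simps)
    show "has_level (adjoin H g) N"
      using N unfolding has_level_def adjoin_def by (auto intro!: exI[of _ 0] simp: scale_simps)
    fix x y assume "x \<in> adjoin H g" "y \<in> adjoin H g"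
    then obtain i j where "x - scale i g \<in> H" "y - scale j g \<in> H"
      by (auto simp: adjoin_def)
    then have "(x - scale i g) - (y - scale j g) \<in> H" by (rule Lat_diff[OF H])
    then have "(x - y) - scale (i - j) g \<in> H" by (simp add: scale_simps algebra_simps)
    then show "x - y \<in> adjoin H g" by (auto simp: adjoin_def)
  qed
qed

lemma adjoin_supset: "H \<subseteq> adjoin H g"
  unfolding adjoin_def by (auto intro!: exI[of _ 0] simp: scale_simps)

lemma adjoin_mem: "g \<in> adjoin H g"
  unfolding adjoin_def using Lat_zero[OF H] by (auto intro!: exI[of _ 1] simp: scale_simps)

lemma adjoin_subset_iff:
  assumes "L \<in> Lat"
  shows "adjoin H g \<subseteq> L \<longleftrightarrow> H \<subseteq> L \<and> g \<in> L"
proof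
  assume "adjoin H g \<subseteq> L"
  then show "H \<subseteq> L \<and> g \<in> L" using adjoin_supset adjoin_mem by blast
next
  assume *: "H \<subseteq> L \<and> g \<in> L"
  show "adjoin H g \<subseteq> L"
  proof
    fix x assume "x \<in> adjoin H g"
    then obtain i where "x - scale i g \<in> L" using * by (auto simp: adjoin_def)
    then show "x \<in> L" using * Lat_diff_iff[OF assms Lat_scale[OF assms]] by blast
  qed
qed

text \<open>
  The subgroup generated by \<open>H\<close> and \<open>g\<close> is the disjoint union of the translates of \<open>H\<close> by the
  multiples \<open>i g\<close> with \<open>i\<close> below the order of \<open>g\<close> modulo \<open>H\<close>.
\<close>

lemma idx_adjoin: "idx (adjoin H g) * p ^ ord_exp H g = idx H"
proof -
  obtain N where N: "has_level H N" using Lat_level[OF H] by blast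
  define k where "k = ord_exp H g"
  have mem: "scale i g \<in> H \<longleftrightarrow> int p ^ k dvd i" for i
    unfolding k_def by (rule scale_mem_iff)
  let ?C = "\<lambda>i. {x \<in> box N. x - scale i g \<in> H}"
  have "box N \<inter> adjoin H g = (\<Union>i\<in>{0..<int p ^ k}. ?C i)"
  proof safe
    fix x assume x: "x \<in> box N" "x \<in> adjoin H g"
    then obtain i where i: "x - scale i g \<in> H" by (auto simp: adjoin_def)
    have "scale (i - i mod int p ^ k) g \<in> H" by (simp add: mem dvd_minus_mod)
    then have "(x - scale i g) + scale (i - i mod int p ^ k) g \<in> H" by (rule Lat_add[OF H i])
    then have "x - scale (i mod int p ^ k) g \<in> H" by (simp add: scale_simps)
    moreover have "i mod int p ^ k \<in> {0..<int p ^ k}" using p_gt_0 by simp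
    ultimately show "x \<in> (\<Union>i\<in>{0..<int p ^ k}. ?C i)" using x(1) by blast
  qed (auto simp: adjoin_def)
  also have "card \<dots> = (\<Sum>i\<in>{0..<int p ^ k}. card (?C i))"
  proof (intro card_UN_disjoint ballI impI)
    fix i j assume ij: "i \<in> {0..<int p ^ k}" "j \<in> {0..<int p ^ k}" "i \<noteq> j"
    show "?C i \<inter> ?C j = {}"
    proof (rule ccontr)
      assume "?C i \<inter> ?C j \<noteq> {}"
      then obtain x where "x - scale j g \<in> H" "x - scale i g \<in> H" by blast
      then have "(x - scale j g) - (x - scale i g) \<in> H" by (rule Lat_diff[OF H])
      then have "int p ^ k dvd i - j" by (simp add: scale_simps flip: mem)
      then have "i mod int p ^ k = j mod int p ^ k" by (simp add: mod_eq_dvd_iff)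
      then show False using ij by simp
    qed
  qed (auto simp: finite_box)
  also have "\<dots> = p ^ k * card (box N \<inter> H)"
    by (simp add: card_box_coset[OF H N] flip: of_nat_power)
  finally have eq: "card (box N \<inter> adjoin H g) = p ^ k * card (box N \<inter> H)" .
  have "card (box N \<inter> adjoin H g) * idx (adjoin H g) = card (box N \<inter> H) * idx H"
    using card_box_Lat[OF H N]
      card_box_Lat[OF adjoin_Lat has_level_supset[OF N adjoin_supset]] by simp
  moreover have "card (box N \<inter> H) > 0" using H N by (rule card_box_Lat_pos)
  ultimately show ?thesis
    unfolding eq k_def by (simp add: mult_ac)
qed

end

lemma ord_exp_le:
  assumes "H \<in> Lat" "L \<in> Lat" "H \<subseteq> L" "g \<in> L" "idx H = idx L * p ^ m"
  shows "ord_exp H g \<le> m" and "idx (adjoin H g) = idx L * p ^ (m - ord_exp H g)"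
proof -
  have "adjoin H g \<subseteq> L" using assms by (simp add: adjoin_subset_iff)
  then obtain n where n: "idx (adjoin H g) = idx L * p ^ n"
    using idx_quotient assms adjoin_Lat by metis
  then have "idx L * (p ^ n * p ^ ord_exp H g) = idx L * p ^ m"
    using idx_adjoin[OF assms(1), of g] assms(5) by (simp add: mult.assoc)
  then have "p ^ (n + ord_exp H g) = p ^ m"
    using idx_pos[OF assms(2)] by (simp add: power_add)
  then have "n + ord_exp H g = m" using p_gt_1 by simp
  then show "ord_exp H g \<le> m" "idx (adjoin H g) = idx L * p ^ (m - ord_exp H g)"
    using n by auto
qed

lemma torsion_Lat:
  assumes "H \<in> Lat" "L \<in> Lat" "H \<subseteq> L"
  shows "{g \<in> L. scale n g \<in> H} \<in> Lat" and "H \<subseteq> {g \<in> L. scale n g \<in> H}"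
proof -
  show sub: "H \<subseteq> {g \<in> L. scale n g \<in> H}"
    using assms Lat_scale by blast
  obtain N where N: "has_level H N" using Lat_level[OF assms(1)] by blast
  show "{g \<in> L. scale n g \<in> H} \<in> Lat"
    by (rule LatI[OF _ _ has_level_supset[OF N sub]])
      (use assms in \<open>auto simp: scale_simps Lat_zero Lat_diff\<close>)
qed

text \<open>
  The orders of the subgroups \<open>D k\<close> of elements of the \<open>p\<close>-group \<open>L / H\<close> killed by \<open>p ^ k\<close> strictly
  increase, so that they grow by a factor of at least \<open>p\<close>, until \<open>D k\<close> is the whole group: once
  \<open>D k = D (Suc k)\<close>, no element has an order larger than \<open>p ^ k\<close>.
\<close>

lemma idx_torsion_dvd:
  assumes HL: "H \<in> Lat" "L \<in> Lat" "H \<subseteq> L" and m: "idx H = idx L * p ^ m" and "k \<le> m"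
  shows "idx {g \<in> L. scale (int p ^ k) g \<in> H} * p ^ k dvd idx H"
  using \<open>k \<le> m\<close>
proof (induction k)
  case 0
  have "{g \<in> L. scale (int p ^ 0) g \<in> H} = H" using HL by (auto simp: scale_simps)
  then show ?case by simp
next
  case (Suc k)
  define D where "D k = {g \<in> L. scale (int p ^ k) g \<in> H}" for k
  have D: "D k \<in> Lat" for k
    unfolding D_def by (rule torsion_Lat[OF HL])
  have step: "scale (int p) g \<in> D k \<longleftrightarrow> g \<in> D (Suc k)" if "g \<in> L" for g k
    using that HL by (simp add: D_def scale_simps Lat_scale mult.commute)
  have mono: "D k \<subseteq> D (Suc k)" for k
  proof
    fix g assume g: "g \<in> D k"
    then have "scale (int p) g \<in> D k" by (rule Lat_scale[OF D])
    then show "g \<in> D (Suc k)" using g step by (simp add: D_def)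
  qed
  show ?case
  proof (cases "D k = D (Suc k)")
    case True
    have "D (k + j) = D k" for j
    proof (induction j)
      case (Suc j)
      show ?case
      proof
        show "D k \<subseteq> D (k + Suc j)" using Suc mono[of "k + j"] by simp
        show "D (k + Suc j) \<subseteq> D k"
        proof
          fix g assume g: "g \<in> D (k + Suc j)"
          then have "g \<in> L" by (simp add: D_def)
          then have "scale (int p) g \<in> D k" using g step[of g "k + j"] Suc by simp
          then show "g \<in> D k" using step[OF \<open>g \<in> L\<close>, of k] True by blast
        qed
      qed
    qed simp
    moreover obtain N where N: "has_level H N" using Lat_level[OF HL(1)] by blast
    then have "has_level H (k + N)" using HL(1) by (rule has_level_mono) simp
    then have "D (k + N) = L" by (auto simp: D_def has_level_def)
    ultimately have "D (Suc k) = L" using True by metis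
    then have "idx (D (Suc k)) * p ^ Suc k dvd idx L * p ^ m"
      using Suc.prems by (auto intro!: mult_dvd_mono le_imp_power_dvd simp del: power_Suc)
    then show ?thesis by (simp only: D_def m)
  next
    case False
    then have "idx (D (Suc k)) * p dvd idx (D k)"
      by (intro idx_dvd D mono)
    then have "(idx (D (Suc k)) * p) * p ^ k dvd idx (D k) * p ^ k" by (rule mult_dvd_mono) simp
    also have "\<dots> dvd idx H" using Suc by (simp add: D_def)
    finally show ?thesis by (simp add: D_def mult_ac)
  qed
qed

text \<open>
  The projection of \<open>L\<close> to the first coordinate is generated by \<open>p ^ fst_exp L\<close>.
\<close>

definition fst_exp :: "(int \<times> int) set \<Rightarrow> nat" where
  "fst_exp L = (LEAST a. \<exists>y. (int p ^ a, y) \<in> L)"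

lemma fst_Lat_iff:
  assumes L: "L \<in> Lat"
  shows "(\<exists>y. (i, y) \<in> L) \<longleftrightarrow> int p ^ fst_exp L dvd i"
proof -
  obtain N where N: "has_level L N" using Lat_level[OF L] by blast
  have "{i. \<exists>y. (i, y) \<in> L} = {i. int p ^ (LEAST c. int p ^ c \<in> {i. \<exists>y. (i, y) \<in> L}) dvd i}"
  proof (rule ideal_eq_multiples)
    show "0 \<in> {i. \<exists>y. (i, y) \<in> L}" using Lat_zero[OF L] by (auto simp: zero_prod_def)
    have "scale (int p ^ N) (1, 0) \<in> L" using N by (simp add: has_level_def)
    then show "int p ^ N \<in> {i. \<exists>y. (i, y) \<in> L}" by (auto simp: scale_def)
    fix i j assume "i \<in> {i. \<exists>y. (i, y) \<in> L}" "j \<in> {i. \<exists>y. (i, y) \<in> L}"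
    then show "i - j \<in> {i. \<exists>y. (i, y) \<in> L}"
      using Lat_diff[OF L] by (fastforce simp: minus_prod_def)
  qed
  then show ?thesis unfolding fst_exp_def by auto
qed

lemma snd_Lat_iff:
  assumes L: "L \<in> Lat"
  obtains c where "\<And>y. (0, y) \<in> L \<longleftrightarrow> int p ^ c dvd y"
proof -
  obtain N where N: "has_level L N" using Lat_level[OF L] by blast
  have "{y. (0, y) \<in> L} = {i. int p ^ (LEAST c. int p ^ c \<in> {y. (0, y) \<in> L}) dvd i}"
  proof (rule ideal_eq_multiples)
    show "0 \<in> {y. (0, y) \<in> L}" using Lat_zero[OF L] by (auto simp: zero_prod_def)
    have "scale (int p ^ N) (0, 1) \<in> L" using N by (simp add: has_level_def)
    then show "int p ^ N \<in> {y. (0, y) \<in> L}" by (auto simp: scale_def)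
    fix i j assume "i \<in> {y. (0, y) \<in> L}" "j \<in> {y. (0, y) \<in> L}"
    then show "i - j \<in> {y. (0, y) \<in> L}"
      using Lat_diff[OF L, of "(0, i)" "(0, j)"] by simp
  qed
  then show ?thesis using that by blast
qed

text \<open>
  If \<open>(p ^ a, b)\<close> and \<open>(0, p ^ c)\<close> form a basis of \<open>L\<close>, then \<open>M\<close> is generated by \<open>(p ^ a, b)\<close> and
  \<open>(0, p ^ Suc c)\<close>. Suppose that \<open>K\<close> contains \<open>M\<close> properly and has the same first projection as
  \<open>L\<close>. Then subtraction of multiples of \<open>(p ^ a, b)\<close> yields an element of \<open>K\<close> outside \<open>M\<close> on the
  second axis, so that \<open>K\<close> contains \<open>(0, p ^ c)\<close> and hence \<open>L\<close>; if the indices agree, \<open>K = L\<close>.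
\<close>

lemma triangular_sublattice:
  assumes L: "L \<in> Lat"
  obtains M where "M \<in> Lat" "M \<subseteq> L" "idx M = idx L * p"
    "\<And>K. K \<in> Lat \<Longrightarrow> M \<subseteq> K \<Longrightarrow> idx K = idx L \<Longrightarrow> K \<noteq> L \<Longrightarrow> fst_exp K < fst_exp L"
proof -
  define a where "a = fst_exp L"
  obtain c where c: "\<And>y. (0, y) \<in> L \<longleftrightarrow> int p ^ c dvd y" using snd_Lat_iff[OF L] by blast
  obtain b where b: "(int p ^ a, b) \<in> L"
    using fst_Lat_iff[OF L, of "int p ^ a"] unfolding a_def by auto
  define M where "M = {x. \<exists>i m. x = (i * int p ^ a, i * b + m * int p ^ Suc c)}"
  have L_eq: "\<exists>i m. x = (i * int p ^ a, i * b + m * int p ^ c)" if x: "x \<in> L" for x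
  proof -
    obtain i where i: "fst x = i * int p ^ a"
    proof -
      have "(fst x, snd x) \<in> L" using x by simp
      then have "int p ^ a dvd fst x" unfolding a_def using fst_Lat_iff[OF L] by blast
      then obtain i where "fst x = int p ^ a * i" by (rule dvdE)
      then show ?thesis using that[of i] by (simp only: mult.commute)
    qed
    have "x - scale i (int p ^ a, b) \<in> L"
      using x b by (intro Lat_diff[OF L] Lat_scale[OF L])
    then have "(0, snd x - i * b) \<in> L" by (simp add: scale_def i minus_prod_def)
    then obtain m where "snd x - i * b = int p ^ c * m" using c by (auto elim!: dvdE)
    then show ?thesis using i by (auto simp: prod_eq_iff algebra_simps)
  qed
  have gen1: "(int p ^ a, b) \<in> M"
    unfolding M_def by (force intro: exI[of _ 1] exI[of _ 0])
  have gen2: "(0, int p ^ Suc c) \<in> M"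
    unfolding M_def by (force intro: exI[of _ 1] exI[of _ 0])
  have in_L: "(0, int p ^ c) \<in> L" using c by simp
  have M_sub: "M \<subseteq> L"
  proof
    fix x assume "x \<in> M"
    then obtain i m where "x = scale i (int p ^ a, b) + scale (m * int p) (0, int p ^ c)"
      by (auto simp: M_def scale_def mult_ac)
    then show "x \<in> L" using b in_L by (simp add: Lat_add Lat_scale L)
  qed
  obtain N where N: "has_level L N" using Lat_level[OF L] by blast
  have M: "M \<in> Lat"
  proof (rule LatI)
    show "0 \<in> M" unfolding M_def by (force simp: zero_prod_def intro: exI[of _ 0])
    show "has_level M (Suc N)"
      unfolding has_level_def
    proof
      fix x
      obtain i m where im: "scale (int p ^ N) x = (i * int p ^ a, i * b + m * int p ^ c)"
        using L_eq[of "scale (int p ^ N) x"] N unfolding has_level_def by blast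
      have "scale (int p ^ Suc N) x = scale (int p) (scale (int p ^ N) x)"
        by (simp add: scale_simps)
      also have "\<dots> = ((int p * i) * int p ^ a, (int p * i) * b + m * int p ^ Suc c)"
        unfolding im by (simp add: scale_def algebra_simps)
      finally show "scale (int p ^ Suc N) x \<in> M" by (auto simp: M_def)
    qed
    fix x y assume "x \<in> M" "y \<in> M"
    then obtain i m j n where
      "x = (i * int p ^ a, i * b + m * int p ^ Suc c)"
      "y = (j * int p ^ a, j * b + n * int p ^ Suc c)" by (auto simp: M_def)
    then have "x - y = ((i - j) * int p ^ a, (i - j) * b + (m - n) * int p ^ Suc c)"
      by (simp add: algebra_simps)
    then show "x - y \<in> M" by (auto simp: M_def)
  qed
  have adj: "adjoin M (0, int p ^ c) = L"
  proof
    show "adjoin M (0, int p ^ c) \<subseteq> L" using M_sub in_L by (simp add: adjoin_subset_iff[OF M L])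
    show "L \<subseteq> adjoin M (0, int p ^ c)"
    proof
      fix x assume "x \<in> L"
      then obtain i m where "x = (i * int p ^ a, i * b + m * int p ^ c)" using L_eq by blast
      then have "x - scale m (0, int p ^ c) = scale i (int p ^ a, b)" by (simp add: scale_def)
      then have "x - scale m (0, int p ^ c) \<in> M" using Lat_scale[OF M gen1] by simp
      then show "x \<in> adjoin M (0, int p ^ c)" by (auto simp: adjoin_def)
    qed
  qed
  have "(0, int p ^ c) \<notin> M"
  proof
    assume "(0, int p ^ c) \<in> M"
    then obtain i m where "i * int p ^ a = 0" "int p ^ c = i * b + m * int p ^ Suc c"
      by (auto simp: M_def)
    then have "int p ^ c * (m * int p) = int p ^ c * 1" using p_gt_0 by simp
    then have "m * int p = 1" using p_gt_0 by (simp only: mult_cancel_left) simp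
    then have "int p dvd 1" by (metis dvd_triv_right)
    then show False using p_gt_1 by simp
  qed
  then have "\<not> ord_exp M (0, int p ^ c) \<le> 0"
    by (simp only: ord_exp_le_iff[OF M]) (simp add: scale_simps)
  moreover have "ord_exp M (0, int p ^ c) \<le> 1"
    using gen2 by (simp add: ord_exp_le_iff[OF M] scale_def)
  ultimately have "ord_exp M (0, int p ^ c) = 1" by simp
  then have idx_M: "idx M = idx L * p"
    using idx_adjoin[OF M, of "(0, int p ^ c)"] adj by simp
  show ?thesis
  proof (rule that[OF M M_sub idx_M])
    fix K assume K: "K \<in> Lat" and M_K: "M \<subseteq> K" and idx_K: "idx K = idx L" and "K \<noteq> L"
    show "fst_exp K < fst_exp L"
    proof (rule ccontr)
      assume "\<not> fst_exp K < fst_exp L"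
      have "M \<noteq> K" using idx_K idx_M idx_pos[OF L] p_gt_1 by auto
      then obtain x where x: "x \<in> K" "x \<notin> M" using M_K by blast
      have "int p ^ a dvd int p ^ fst_exp K"
        using \<open>\<not> _ < _\<close> by (simp add: a_def le_imp_power_dvd)
      also have "int p ^ fst_exp K dvd fst x"
        using x(1) by (subst fst_Lat_iff[OF K, symmetric]) (metis prod.collapse)
      finally obtain i where "fst x = int p ^ a * i" by (rule dvdE)
      then have i: "fst x = i * int p ^ a" by (simp only: mult.commute)
      define y where "y = snd x - i * b"
      have y: "x = scale i (int p ^ a, b) + (0, y)"
        by (simp add: y_def scale_def prod_eq_iff i)
      have "scale i (int p ^ a, b) \<in> M" using gen1 Lat_scale[OF M] by blast
      then have yK: "(0, y) \<in> K" and yM: "(0, y) \<notin> M"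
        using x M_K Lat_diff[OF K, of x "scale i (int p ^ a, b)"]
          Lat_add[OF M, of "scale i (int p ^ a, b)" "(0, y)"] by (auto simp: y)
      obtain d where d: "\<And>y. (0, y) \<in> K \<longleftrightarrow> int p ^ d dvd y" using snd_Lat_iff[OF K] by blast
      have "\<not> int p ^ Suc c dvd y"
        using yM Lat_scale[OF M gen2] by (auto simp: scale_def mult.commute elim!: dvdE)
      then have "\<not> Suc c \<le> d"
        using yK d le_imp_power_dvd dvd_trans by blast
      then have "(0, int p ^ c) \<in> K" by (simp add: d le_imp_power_dvd)
      then have "L \<subseteq> K" using M_K adjoin_subset_iff[OF M K] adj by metis
      then show False using idx_eq_imp_eq[OF L K] idx_K \<open>K \<noteq> L\<close> by auto
    qed
  qed
qed

section \<open>Witt polynomials of plane subgroups and Burnside congruences\<close>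

text \<open>
  The Witt polynomial of the transitive set \<open>\<int>\<^sup>2 / L\<close>, see \<open>witt_poly_eq_plane_witt\<close>.
\<close>

definition plane_witt :: "(int \<times> int) set \<Rightarrow> ((int \<times> int) set \<Rightarrow> 'r::comm_ring_1) \<Rightarrow> 'r" where
  "plane_witt L a = (\<Sum>K\<in>{K \<in> Lat. L \<subseteq> K}. of_nat (idx K) * a K ^ (idx L div idx K))"

lemma plane_witt_split:
  assumes L: "L \<in> Lat"
  shows "plane_witt L a = of_nat (idx L) * a L +
    (\<Sum>K\<in>{K \<in> Lat. L \<subset> K}. of_nat (idx K) * a K ^ (idx L div idx K))"
proof -
  have "{K \<in> Lat. L \<subseteq> K} = insert L {K \<in> Lat. L \<subset> K}" using L by auto
  moreover have "finite {K \<in> Lat. L \<subset> K}"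
    by (rule finite_subset[OF _ finite_supLat[OF L]]) auto
  ultimately show ?thesis using idx_pos[OF L] by (simp add: plane_witt_def)
qed

lemma plane_witt_cong: "(\<And>K. K \<in> Lat \<Longrightarrow> L \<subseteq> K \<Longrightarrow> a K = b K) \<Longrightarrow> plane_witt L a = plane_witt L b"
  by (simp add: plane_witt_def)

lemma plane_witt_injective:
  fixes a b :: "(int \<times> int) set \<Rightarrow> 'v zpoly"
  assumes eq: "\<And>L. L \<in> Lat \<Longrightarrow> plane_witt L a = plane_witt L b" and "L \<in> Lat"
  shows "a L = b L"
  using \<open>L \<in> Lat\<close>
proof (induction "idx L" arbitrary: L rule: less_induct)
  case less
  have "a K = b K" if "K \<in> Lat" "L \<subset> K" for K
    using that less idx_less[of L K] by auto
  then have "of_nat (idx L) * a L = of_nat (idx L) * b L"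
    using eq[OF less.prems] by (simp add: plane_witt_split[OF less.prems])
  then show ?case using idx_pos[OF less.prems] by (rule of_nat_mult_cancel)
qed

text \<open>
  In terms of \<open>\<int>\<^sup>2 / H\<close> the congruence says that the sum over its elements is divisible by its order:
  each element is counted \<open>card (box N \<inter> H)\<close> times, and \<open>p ^ (2 * N)\<close> is this number times the
  index of \<open>H\<close>. If \<open>w K\<close> is the number of fixed points of \<open>K\<close> on a finite set of the group
  \<open>\<int>\<^sup>2 / H\<close>, then the sum without Frobenius is the order of the group times the number of orbits. The
  Frobenius twist turns the various powers of one variable in the sum into the same power.
\<close>

definition burnside_cong :: "((int \<times> int) set \<Rightarrow> 'v zpoly) \<Rightarrow> (int \<times> int) set \<Rightarrow> bool" where
  "burnside_cong w H \<longleftrightarrow> (\<forall>N. has_level H N \<longrightarrow>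
     of_nat (p ^ (2 * N)) dvd (\<Sum>g\<in>box N. (frob p ^^ ord_exp H g) (w (adjoin H g))))"

text \<open>
  Let \<open>p ^ m\<close> be the order of \<open>L / H\<close>. The summand at \<open>g\<close> depends only on the exponent \<open>k\<close> of the
  order of \<open>g\<close>: up to the factor \<open>idx L\<close> it is \<open>y k = (frob ^^ k) x ^ p ^ (m - k)\<close>. Since
  \<open>frob z\<close> is congruent to \<open>z ^ p\<close>, consecutive values \<open>y j\<close> and \<open>y (Suc j)\<close> agree modulo
  \<open>p ^ (m - j)\<close>. Summation by parts multiplies \<open>y j - y (Suc j)\<close> with the number of elements killed
  by \<open>p ^ j\<close>, and this number supplies the missing factor \<open>p ^ j\<close> (\<open>idx_torsion_dvd\<close>).
\<close>

lemma frob_power_sum_dvd: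
  fixes x :: "'v zpoly"
  assumes HL: "H \<in> Lat" "L \<in> Lat" "H \<subseteq> L" and N: "has_level H N"
  shows "of_nat (p ^ (2 * N)) dvd (\<Sum>g\<in>box N \<inter> L.
    of_nat (idx L) * (frob p ^^ ord_exp H g) x ^ (idx (adjoin H g) div idx L))"
proof -
  obtain m where m: "idx H = idx L * p ^ m" using idx_quotient[OF HL] by blast
  define y where "y k = (frob p ^^ k) x ^ (p ^ (m - k))" for k
  let ?S = "box N \<inter> L"
  let ?T = "\<lambda>j. {g \<in> ?S. ord_exp H g \<le> j}"
  have fin: "finite ?S" using finite_box by simp
  have summand: "of_nat (idx L) * (frob p ^^ ord_exp H g) x ^ (idx (adjoin H g) div idx L) =
      of_nat (idx L) * y (ord_exp H g)" if "g \<in> ?S" for g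
    using ord_exp_le(2)[OF HL _ m, of g] that idx_pos[OF HL(2)] by (simp add: y_def)
  have telescope: "y (ord_exp H g) =
      y m + (\<Sum>j\<in>{..<m}. if ord_exp H g \<le> j then y j - y (Suc j) else 0)"
    if "g \<in> ?S" for g
  proof -
    have le: "ord_exp H g \<le> m" using ord_exp_le(1)[OF HL _ m] that by simp
    have "(\<Sum>j\<in>{..<m}. if ord_exp H g \<le> j then y j - y (Suc j) else 0) =
        (\<Sum>j\<in>{ord_exp H g..<m}. y j - y (Suc j))"
      by (subst sum.inter_filter[symmetric]) (auto intro!: sum.cong)
    also have "\<dots> = - (\<Sum>j\<in>{ord_exp H g..<m}. y (Suc j) - y j)"
      by (simp flip: sum_negf)
    also have "\<dots> = y (ord_exp H g) - y m"
      by (simp add: sum_Suc_diff'[OF le])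
    finally show ?thesis by simp
  qed
  have "(\<Sum>g\<in>?S. of_nat (idx L) * (frob p ^^ ord_exp H g) x ^ (idx (adjoin H g) div idx L)) =
      of_nat (idx L) * (\<Sum>g\<in>?S. y (ord_exp H g))"
    by (simp add: summand sum_distrib_left)
  also have "(\<Sum>g\<in>?S. y (ord_exp H g)) = of_nat (card ?S) * y m +
      (\<Sum>g\<in>?S. \<Sum>j\<in>{..<m}. if ord_exp H g \<le> j then y j - y (Suc j) else 0)"
    by (simp add: telescope sum.distrib)
  also have "(\<Sum>g\<in>?S. \<Sum>j\<in>{..<m}. if ord_exp H g \<le> j then y j - y (Suc j) else 0) =
      (\<Sum>j\<in>{..<m}. \<Sum>g\<in>?S. if ord_exp H g \<le> j then y j - y (Suc j) else 0)"
    by (rule sum.swap)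
  also have "\<dots> = (\<Sum>j\<in>{..<m}. of_nat (card (?T j)) * (y j - y (Suc j)))"
    using fin by (simp add: sum.inter_filter[symmetric])
  finally have eq: "(\<Sum>g\<in>?S.
        of_nat (idx L) * (frob p ^^ ord_exp H g) x ^ (idx (adjoin H g) div idx L)) =
      of_nat (card ?S * idx L) * y m +
      (\<Sum>j\<in>{..<m}. of_nat (idx L * card (?T j)) * (y j - y (Suc j)))"
    by (simp add: distrib_left sum_distrib_left mult_ac)
  have "of_nat (p ^ (2 * N)) dvd of_nat (idx L * card (?T j)) * (y j - y (Suc j))"
    if "j < m" for j
  proof -
    define D where "D = {g \<in> L. scale (int p ^ j) g \<in> H}"
    have D: "D \<in> Lat" "H \<subseteq> D" unfolding D_def by (rule torsion_Lat[OF HL])+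
    have T: "?T j = box N \<inter> D" by (auto simp: D_def ord_exp_le_iff[OF HL(1)])
    have card_T: "card (?T j) * idx D = p ^ (2 * N)"
      unfolding T by (rule card_box_Lat[OF D(1) has_level_supset[OF N D(2)]])
    have "idx D * p ^ j dvd idx H"
      unfolding D_def using that by (intro idx_torsion_dvd[OF HL m]) simp
    then obtain e where "idx H = idx D * p ^ j * e" by (rule dvdE)
    then have "p ^ j * (idx D * e) = idx H" by (simp only: mult_ac)
    also have "\<dots> = p ^ j * (idx L * p ^ (m - j))"
      using that by (simp add: m flip: power_add)
    finally have "p ^ j * (idx D * e) = p ^ j * (idx L * p ^ (m - j))" .
    then have e: "idx D * e = idx L * p ^ (m - j)" using p_gt_0 by simp
    define i where "i = m - Suc j"
    have i: "m - j = Suc i" using that by (simp add: i_def)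
    have "of_nat p dvd (frob p ^^ j) x ^ p - frob p ((frob p ^^ j) x)"
      using frob_cong_power[OF prime_p] by (metis dvd_minus_iff minus_diff_eq)
    then have "of_nat (p ^ Suc i) dvd
        ((frob p ^^ j) x ^ p) ^ (p ^ i) - (frob p ((frob p ^^ j) x)) ^ (p ^ i)"
      by (rule dvd_prime_power_diff)
    also have "\<dots> = y j - y (Suc j)"
      by (simp add: y_def i i_def[symmetric] power_mult)
    finally obtain z where z: "y j - y (Suc j) = of_nat (p ^ (m - j)) * z"
      unfolding i by (rule dvdE)
    have "of_nat (idx L * card (?T j)) * (y j - y (Suc j)) =
        of_nat (card (?T j) * (idx L * p ^ (m - j))) * z"
      unfolding z by (simp only: of_nat_mult mult_ac)
    also have "\<dots> = of_nat (p ^ (2 * N)) * (of_nat e * z)"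
      unfolding e[symmetric] card_T[symmetric] by (simp only: of_nat_mult mult_ac)
    finally show ?thesis by simp
  qed
  then have "of_nat (p ^ (2 * N)) dvd
      (\<Sum>j\<in>{..<m}. of_nat (idx L * card (?T j)) * (y j - y (Suc j)))"
    by (rule dvd_sum) (rule lessThan_iff[THEN iffD1])
  moreover have card_S: "card ?S * idx L = p ^ (2 * N)"
    by (rule card_box_Lat[OF HL(2) has_level_supset[OF N HL(3)]])
  have "of_nat (p ^ (2 * N)) dvd of_nat (card ?S * idx L) * y m"
    unfolding card_S by (rule dvd_triv_left)
  ultimately show ?thesis
    unfolding eq by (rule dvd_add[rotated])
qed

text \<open>
  A subgroup contains \<open>adjoin H g\<close> exactly if it contains \<open>H\<close> and \<open>g\<close>.
\<close>

lemma sum_adjoin_swap: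
  assumes H: "H \<in> Lat"
  shows "(\<Sum>g\<in>box N. \<Sum>L\<in>{L \<in> Lat. adjoin H g \<subseteq> L}. f g L) =
    (\<Sum>L\<in>{L \<in> Lat. H \<subseteq> L}. \<Sum>g\<in>box N \<inter> L. f g L)"
proof -
  have "{L \<in> Lat. adjoin H g \<subseteq> L} = {L \<in> {L \<in> Lat. H \<subseteq> L}. g \<in> L}" for g
    using adjoin_subset_iff[OF H, of _ g] by blast
  then have "(\<Sum>g\<in>box N. \<Sum>L\<in>{L \<in> Lat. adjoin H g \<subseteq> L}. f g L) =
      (\<Sum>g\<in>box N. \<Sum>L\<in>{L \<in> {L \<in> Lat. H \<subseteq> L}. g \<in> L}. f g L)"
    by simp
  also have "\<dots> = (\<Sum>L\<in>{L \<in> Lat. H \<subseteq> L}. \<Sum>g\<in>{g \<in> box N. g \<in> L}. f g L)"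
    by (rule sum.swap_restrict[OF finite_box finite_supLat[OF H]])
  finally show ?thesis by (simp add: Int_def)
qed

text \<open>
  After the exchange of the summations the part which belongs to each single \<open>L\<close> is divisible.
\<close>

lemma burnside_cong_plane_witt:
  assumes H: "H \<in> Lat"
  shows "burnside_cong (\<lambda>K. plane_witt K s) H"
  unfolding burnside_cong_def
proof (intro allI impI)
  fix N assume N: "has_level H N"
  interpret f: unital_ring_map "frob p ^^ k :: 'a zpoly \<Rightarrow> 'a zpoly" for k
    by (rule unital_ring_map_frob_pow)
  have "(\<Sum>g\<in>box N. (frob p ^^ ord_exp H g) (plane_witt (adjoin H g) s)) =
      (\<Sum>g\<in>box N. \<Sum>L\<in>{L \<in> Lat. adjoin H g \<subseteq> L}.
        of_nat (idx L) * (frob p ^^ ord_exp H g) (s L) ^ (idx (adjoin H g) div idx L))"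
    by (simp add: plane_witt_def f.map_sum f.map_mult f.map_power f.map_of_nat)
  also have "\<dots> = (\<Sum>L\<in>{L \<in> Lat. H \<subseteq> L}. \<Sum>g\<in>box N \<inter> L.
        of_nat (idx L) * (frob p ^^ ord_exp H g) (s L) ^ (idx (adjoin H g) div idx L))"
    by (rule sum_adjoin_swap[OF H])
  also have "of_nat (p ^ (2 * N)) dvd \<dots>"
    by (rule dvd_sum, rule frob_power_sum_dvd[OF H _ _ N]) simp_all
  finally show "of_nat (p ^ (2 * N)) dvd
      (\<Sum>g\<in>box N. (frob p ^^ ord_exp H g) (plane_witt (adjoin H g) s))" .
qed

lemma burnside_cong_add:
  assumes "burnside_cong v H" "burnside_cong w H"
  shows "burnside_cong (\<lambda>K. v K + w K) H"
proof -
  interpret f: unital_ring_map "frob p ^^ k :: 'a zpoly \<Rightarrow> 'a zpoly" for k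
    by (rule unital_ring_map_frob_pow)
  show ?thesis
    using assms unfolding burnside_cong_def by (simp add: f.map_add sum.distrib)
qed

text \<open>
  On variables the Frobenius twist turns the exponent \<open>idx (adjoin H g) div idx L\<close> into
  \<open>idx H div idx L\<close>, so that each pair \<open>L\<close>, \<open>M\<close> contributes one and the same monomial for every
  \<open>g\<close> in \<open>L \<inter> M\<close>. The number of these \<open>g\<close>, multiplied with both indices, is divisible by the
  size of the box because the index of \<open>L \<inter> M\<close> divides the product of the indices.
\<close>

lemma burnside_cong_plane_witt_zvar_mult:
  assumes H: "H \<in> Lat"
  shows "burnside_cong
    (\<lambda>K. plane_witt K (\<lambda>L. zvar (i L) :: 'v zpoly) * plane_witt K (\<lambda>L. zvar (j L))) H"
  unfolding burnside_cong_def
proof (intro allI impI)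
  fix N assume N: "has_level H N"
  interpret f: unital_ring_map "frob p ^^ k :: 'v zpoly \<Rightarrow> 'v zpoly" for k
    by (rule unital_ring_map_frob_pow)
  define A :: "((int \<times> int) set \<Rightarrow> 'v) \<Rightarrow> (int \<times> int) set \<Rightarrow> 'v zpoly" where
    "A i L = of_nat (idx L) * zvar (i L) ^ (idx H div idx L)" for i L
  let ?S = "{L \<in> Lat. H \<subseteq> L}"
  have fin: "finite (?S \<times> ?S)" using finite_supLat[OF H] by simp
  have frob_plane_witt: "(frob p ^^ ord_exp H g) (plane_witt (adjoin H g) (\<lambda>L. zvar (i L))) =
      (\<Sum>L\<in>{L \<in> ?S. g \<in> L}. A i L)" for g and i :: "(int \<times> int) set \<Rightarrow> 'v"
  proof -
    have "p ^ ord_exp H g * (idx (adjoin H g) div idx L) = idx H div idx L"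
      if "L \<in> Lat" "adjoin H g \<subseteq> L" for L
      using idx_dvd(1)[OF adjoin_Lat[OF H] that] idx_adjoin[OF H, of g]
      by (metis div_mult_swap mult.commute)
    then have "(frob p ^^ ord_exp H g) (plane_witt (adjoin H g) (\<lambda>L. zvar (i L))) =
        (\<Sum>L\<in>{L \<in> Lat. adjoin H g \<subseteq> L}. A i L)"
      by (simp add: plane_witt_def A_def f.map_sum f.map_mult f.map_power f.map_of_nat frob_pow_zvar
          flip: power_mult)
    also have "{L \<in> Lat. adjoin H g \<subseteq> L} = {L \<in> ?S. g \<in> L}"
      using adjoin_subset_iff[OF H, of _ g] by blast
    finally show ?thesis .
  qed
  have "(\<Sum>g\<in>box N. (frob p ^^ ord_exp H g)
        (plane_witt (adjoin H g) (\<lambda>L. zvar (i L)) * plane_witt (adjoin H g) (\<lambda>L. zvar (j L)))) =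
      (\<Sum>g\<in>box N. \<Sum>(L, M)\<in>{L \<in> ?S. g \<in> L} \<times> {M \<in> ?S. g \<in> M}. A i L * A j M)"
    by (simp add: f.map_mult frob_plane_witt sum_product sum.cartesian_product)
  also have "\<dots> = (\<Sum>g\<in>box N. \<Sum>LM\<in>{LM \<in> ?S \<times> ?S. g \<in> fst LM \<inter> snd LM}.
      A i (fst LM) * A j (snd LM))"
    by (intro sum.cong) auto
  also have "\<dots> = (\<Sum>LM\<in>?S \<times> ?S. \<Sum>g\<in>{g \<in> box N. g \<in> fst LM \<inter> snd LM}.
      A i (fst LM) * A j (snd LM))"
    by (rule sum.swap_restrict[OF finite_box fin])
  also have "of_nat (p ^ (2 * N)) dvd \<dots>"
  proof (rule dvd_sum)
    fix LM assume LM: "LM \<in> ?S \<times> ?S"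
    define L M where "L = fst LM" and "M = snd LM"
    have LM: "L \<in> Lat" "M \<in> Lat" "H \<subseteq> L \<inter> M" using LM by (auto simp: L_def M_def)
    have card: "card (box N \<inter> (L \<inter> M)) * idx (L \<inter> M) = p ^ (2 * N)"
      using LM N by (intro card_box_Lat Lat_Int has_level_supset[OF N])
    obtain e where e: "idx L * idx M = idx (L \<inter> M) * e"
      using idx_Int_dvd[OF LM(1,2)] by (rule dvdE)
    have "(\<Sum>g\<in>{g \<in> box N. g \<in> L \<inter> M}. A i L * A j M) =
        of_nat (card (box N \<inter> (L \<inter> M))) * (A i L * A j M)"
      by (simp add: Int_def)
    also have "\<dots> = of_nat (card (box N \<inter> (L \<inter> M)) * (idx L * idx M)) *
        (zvar (i L) ^ (idx H div idx L) * zvar (j M) ^ (idx H div idx M))"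
      by (simp add: A_def mult_ac)
    also have "\<dots> = of_nat (p ^ (2 * N)) *
        (of_nat e * (zvar (i L) ^ (idx H div idx L) * zvar (j M) ^ (idx H div idx M)))"
      unfolding e card[symmetric] by (simp only: of_nat_mult mult_ac)
    finally show "of_nat (p ^ (2 * N)) dvd
        (\<Sum>g\<in>{g \<in> box N. g \<in> fst LM \<inter> snd LM}. A i (fst LM) * A j (snd LM))"
      unfolding L_def[symmetric] M_def[symmetric] by simp
  qed
  finally show "of_nat (p ^ (2 * N)) dvd (\<Sum>g\<in>box N. (frob p ^^ ord_exp H g)
        (plane_witt (adjoin H g) (\<lambda>L. zvar (i L)) * plane_witt (adjoin H g) (\<lambda>L. zvar (j L))))" .
qed

text \<open>
  In the difference of the two congruences only the elements \<open>g\<close> of \<open>H\<close> survive, each with the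
  same contribution \<open>v H - w H\<close>.
\<close>

lemma burnside_cong_diff_dvd:
  fixes v w :: "(int \<times> int) set \<Rightarrow> 'v zpoly"
  assumes H: "H \<in> Lat" and cong: "burnside_cong v H" "burnside_cong w H"
    and above: "\<And>K. K \<in> Lat \<Longrightarrow> H \<subset> K \<Longrightarrow> v K = w K"
  shows "of_nat (idx H) dvd v H - w H"
proof -
  interpret f: unital_ring_map "frob p ^^ k :: 'v zpoly \<Rightarrow> 'v zpoly" for k
    by (rule unital_ring_map_frob_pow)
  obtain N where N: "has_level H N" using Lat_level[OF H] by blast
  have "(frob p ^^ ord_exp H g) (v (adjoin H g)) - (frob p ^^ ord_exp H g) (w (adjoin H g)) =
      (if g \<in> H then v H - w H else 0)" for g
  proof (cases "g \<in> H")
    case True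
    then have "adjoin H g = H" using adjoin_supset[OF H] adjoin_subset_iff[OF H H] by blast
    moreover have "ord_exp H g \<le> 0" using True
      by (simp only: ord_exp_le_iff[OF H]) (simp add: scale_simps)
    ultimately show ?thesis using True by simp
  next
    case False
    then have "H \<subset> adjoin H g" using adjoin_supset[OF H] adjoin_mem[OF H] by blast
    then show ?thesis using above adjoin_Lat[OF H] False by simp
  qed
  then have "(\<Sum>g\<in>box N. (frob p ^^ ord_exp H g) (v (adjoin H g))) -
      (\<Sum>g\<in>box N. (frob p ^^ ord_exp H g) (w (adjoin H g))) =
      (\<Sum>g\<in>box N. if g \<in> H then v H - w H else 0)"
    by (simp flip: sum_subtractf)
  also have "\<dots> = of_nat (card (box N \<inter> H)) * (v H - w H)"
    using finite_box by (simp add: sum.inter_filter[symmetric] Int_def)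
  finally have eq: "(\<Sum>g\<in>box N. (frob p ^^ ord_exp H g) (v (adjoin H g))) -
      (\<Sum>g\<in>box N. (frob p ^^ ord_exp H g) (w (adjoin H g))) =
      of_nat (card (box N \<inter> H)) * (v H - w H)" .
  have "of_nat (p ^ (2 * N)) dvd (\<Sum>g\<in>box N. (frob p ^^ ord_exp H g) (v (adjoin H g))) -
      (\<Sum>g\<in>box N. (frob p ^^ ord_exp H g) (w (adjoin H g)))"
    using cong[unfolded burnside_cong_def, rule_format, OF N] by (rule dvd_diff)
  then have "of_nat (p ^ (2 * N)) dvd of_nat (card (box N \<inter> H)) * (v H - w H)"
    unfolding eq .
  then obtain z where z: "of_nat (card (box N \<inter> H)) * (v H - w H) = of_nat (p ^ (2 * N)) * z"
    by (rule dvdE)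
  have "of_nat (card (box N \<inter> H)) * (v H - w H) =
      of_nat (card (box N \<inter> H)) * (of_nat (idx H) * z)"
    unfolding z card_box_Lat[OF H N, symmetric] by (simp only: of_nat_mult mult_ac)
  moreover have "card (box N \<inter> H) > 0" using H N by (rule card_box_Lat_pos)
  ultimately have "v H - w H = of_nat (idx H) * z" by (rule of_nat_mult_cancel)
  then show ?thesis by simp
qed

text \<open>
  The family \<open>s\<close> is found by recursion on the index. Once \<open>s K\<close> is known for all \<open>K\<close> above \<open>H\<close>,
  the ghost components of the family with 0 in place of the unknown \<open>s H\<close> satisfy the congruences
  too, and they agree with \<open>w\<close> above \<open>H\<close>. So the difference at \<open>H\<close> is a multiple of the index,
  and the quotient is \<open>s H\<close>.
\<close>

lemma burnside_cong_imp_plane_witt: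
  fixes w :: "(int \<times> int) set \<Rightarrow> 'v zpoly"
  assumes cong: "\<And>H. H \<in> Lat \<Longrightarrow> burnside_cong w H"
  obtains s where "\<And>H. H \<in> Lat \<Longrightarrow> plane_witt H s = w H"
proof -
  define R where "R = {(K, H). K \<in> Lat \<and> H \<in> Lat \<and> H \<subset> K}"
  define P where "P f H r \<longleftrightarrow> (H \<in> Lat \<longrightarrow> of_nat (idx H) * r +
    (\<Sum>K\<in>{K \<in> Lat. H \<subset> K}. of_nat (idx K) * f K ^ (idx H div idx K)) = w H)"
    for f :: "(int \<times> int) set \<Rightarrow> 'v zpoly" and H r
  have "R \<subseteq> measure idx" by (intro subrelI) (simp add: R_def idx_less)
  then have wf: "wf R" using wf_measure wf_subset by blast
  have "\<exists>s. \<forall>H. P s H (s H)"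
  proof (rule dependent_wf_choice[OF wf])
    fix f g :: "(int \<times> int) set \<Rightarrow> 'v zpoly" and H r
    assume "\<And>K. (K, H) \<in> R \<Longrightarrow> f K = g K"
    then show "P f H r = P g H r"
      by (cases "H \<in> Lat") (simp_all add: P_def R_def)
  next
    fix H and f :: "(int \<times> int) set \<Rightarrow> 'v zpoly"
    assume IH: "\<And>K. (K, H) \<in> R \<Longrightarrow> P f K (f K)"
    show "\<exists>r. P f H r"
    proof (cases "H \<in> Lat")
      case True
      define f' where "f' = f(H := 0)"
      have "w K = plane_witt K f'" if K: "K \<in> Lat" "H \<subset> K" for K
      proof -
        have "plane_witt K f' = plane_witt K f" using K by (intro plane_witt_cong) (auto simp: f'_def)
        then show ?thesis using IH[of K] K True by (simp add: plane_witt_split[OF K(1)] P_def R_def)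
      qed
      then have "of_nat (idx H) dvd w H - plane_witt H f'"
        by (rule burnside_cong_diff_dvd[OF True cong[OF True] burnside_cong_plane_witt[OF True]])
      then obtain r where "w H - plane_witt H f' = of_nat (idx H) * r" by (rule dvdE)
      moreover have "plane_witt H f' =
          (\<Sum>K\<in>{K \<in> Lat. H \<subset> K}. of_nat (idx K) * f K ^ (idx H div idx K))"
      proof -
        have "f' K = f K" if "H \<subset> K" for K using that by (auto simp: f'_def)
        moreover have "f' H = 0" by (simp add: f'_def)
        ultimately show ?thesis by (simp add: plane_witt_split[OF True])
      qed
      ultimately have "P f H r" by (simp add: P_def algebra_simps)
      then show ?thesis ..
    qed (simp add: P_def)
  qed
  then obtain s where s: "P s H (s H)" for H by blast
  show ?thesis
  proof (rule that)
    fix H assume "H \<in> Lat"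
    then show "plane_witt H s = w H" using s[of H] by (simp add: plane_witt_split P_def)
  qed
qed

section \<open>Multiplication by p modulo p\<close>

text \<open>
  The defining equations are solved from small indices upwards: \<open>F\<close> is 0 at indices below \<open>n\<close> and
  \<open>p x\<close> at index \<open>n\<close>. At \<open>M\<close> the terms \<open>n F\<^sub>K\<^sup>p = n p\<^sup>p x\<^sub>K\<^sup>p\<close> with \<open>idx K = n\<close> and \<open>p n F\<^sub>M\<close> on
  the left meet \<open>p n x\<^sub>K\<^sup>p\<close> and \<open>p\<^sup>2 n x\<^sub>M\<close> on the right, and everything is divided by \<open>p n\<close>.
\<close>

lemma p_multiple_mod_p:
  fixes F x :: "(int \<times> int) set \<Rightarrow> 'v zpoly"
  assumes F: "\<And>L. L \<in> Lat \<Longrightarrow> plane_witt L F = of_nat p * plane_witt L x"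
    and x: "\<And>L. L \<in> Lat \<Longrightarrow> idx L < n \<Longrightarrow> x L = 0"
    and M: "M \<in> Lat" "idx M = p * n"
  shows "of_nat p dvd F M - (\<Sum>K\<in>{K \<in> Lat. M \<subseteq> K \<and> idx K = n}. x K ^ p)"
proof -
  have n: "n > 0" using idx_pos[OF M(1)] M(2) by simp
  have zero: "0 ^ (idx L div idx K) = (0 :: 'v zpoly)"
    if "K \<in> Lat" "L \<in> Lat" "L \<subset> K" for K L
    using that idx_div_pos[of L K] by (simp add: zero_power)
  have F_low: "F L = 0" if "L \<in> Lat" "idx L < n" for L
    using that
  proof (induction "idx L" arbitrary: L rule: less_induct)
    case less
    have "F K = 0" "x K = 0" if "K \<in> Lat" "L \<subset> K" for K
      using that less.hyps[of K] less.prems idx_less[of L K] x[of K] by simp_all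
    then have "of_nat (idx L) * F L = of_nat (idx L) * 0"
      using F[OF less.prems(1)] less.prems x
      by (simp add: plane_witt_split[OF less.prems(1)] zero)
    then show ?case using idx_pos[OF less.prems(1)] by (rule of_nat_mult_cancel)
  qed
  have F_n: "F L = of_nat p * x L" if L: "L \<in> Lat" "idx L = n" for L
  proof -
    have "F K = 0" "x K = 0" if "K \<in> Lat" "L \<subset> K" for K
      using that L idx_less[of L K] x[of K] F_low[of K] by simp_all
    then have "of_nat (idx L) * F L = of_nat (idx L) * (of_nat p * x L)"
      using F[OF L(1)] by (simp add: plane_witt_split[OF L(1)] zero L(1) algebra_simps)
    then show ?thesis using idx_pos[OF L(1)] by (rule of_nat_mult_cancel)
  qed
  let ?S = "{K \<in> Lat. M \<subseteq> K \<and> idx K = n}"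
  have upper: "(\<Sum>K\<in>{K \<in> Lat. M \<subset> K}. of_nat (idx K) * a K ^ (idx M div idx K)) =
      of_nat n * (\<Sum>K\<in>?S. a K ^ p)"
    if a: "\<And>L. L \<in> Lat \<Longrightarrow> idx L < n \<Longrightarrow> a L = 0" for a :: "(int \<times> int) set \<Rightarrow> 'v zpoly"
  proof -
    have "finite {K \<in> Lat. M \<subset> K}"
      by (rule finite_subset[OF _ finite_supLat[OF M(1)]]) auto
    moreover have "?S \<subseteq> {K \<in> Lat. M \<subset> K}" using M n p_gt_1 by auto
    moreover have "of_nat (idx K) * a K ^ (idx M div idx K) = 0"
      if "K \<in> {K \<in> Lat. M \<subset> K} - ?S" for K
    proof -
      have K: "K \<in> Lat" "M \<subset> K" "idx K \<noteq> n" using that by auto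
      then have "idx K * p dvd p * n" using idx_dvd(2)[OF M(1), of K] M(2) by auto
      then have "idx K dvd n" using p_gt_0 by (simp add: mult.commute)
      then have "idx K < n" using K(3) n by (auto dest: dvd_imp_le)
      then show ?thesis using a K M(1) by (simp add: zero)
    qed
    ultimately have "(\<Sum>K\<in>{K \<in> Lat. M \<subset> K}. of_nat (idx K) * a K ^ (idx M div idx K)) =
        (\<Sum>K\<in>?S. of_nat (idx K) * a K ^ (idx M div idx K))"
      by (intro sum.mono_neutral_right) auto
    also have "\<dots> = (\<Sum>K\<in>?S. of_nat n * a K ^ p)"
      using M(2) n by (intro sum.cong) auto
    finally show ?thesis by (simp add: sum_distrib_left)
  qed
  have "(\<Sum>K\<in>?S. F K ^ p) = of_nat p * of_nat (p ^ (p - 1)) * (\<Sum>K\<in>?S. x K ^ p)"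
  proof -
    have "of_nat p * of_nat (p ^ (p - 1)) = (of_nat p ^ p :: 'v zpoly)"
      using p_gt_0 by (cases p) simp_all
    moreover have "F K ^ p = of_nat p ^ p * x K ^ p" if "K \<in> ?S" for K
      using that F_n by (simp add: power_mult_distrib)
    ultimately show ?thesis by (simp add: sum_distrib_left)
  qed
  then have "of_nat (p * n) * (F M + of_nat (p ^ (p - 1)) * (\<Sum>K\<in>?S. x K ^ p)) =
      plane_witt M F"
    using F_low by (simp only: plane_witt_split[OF M(1)] upper) (simp add: M(2) algebra_simps)
  also have "\<dots> = of_nat (p * n) * (of_nat p * x M + (\<Sum>K\<in>?S. x K ^ p))"
    unfolding F[OF M(1)]
    using x by (simp only: plane_witt_split[OF M(1)] upper) (simp add: M(2) algebra_simps)
  finally have "F M + of_nat (p ^ (p - 1)) * (\<Sum>K\<in>?S. x K ^ p) =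
      of_nat p * x M + (\<Sum>K\<in>?S. x K ^ p)"
    by (rule of_nat_mult_cancel) (use p_gt_0 n in simp)
  moreover have "of_nat (p ^ (p - 1)) = (of_nat p * of_nat (p ^ (p - 2)) :: 'v zpoly)"
    using p_gt_1 by (simp flip: power_Suc) (simp add: Suc_diff_Suc numeral_2_eq_2)
  ultimately have "F M - (\<Sum>K\<in>?S. x K ^ p) =
      of_nat p * (x M - of_nat (p ^ (p - 2)) * (\<Sum>K\<in>?S. x K ^ p))"
    by (simp add: algebra_simps)
  then show ?thesis by simp
qed

text \<open>
  In the equation for the subgroup \<open>M\<close> of \<open>triangular_sublattice\<close> all terms other than \<open>b L ^ p\<close>
  vanish by induction.
\<close>

lemma vanish_of_upper_sums:
  fixes b :: "(int \<times> int) set \<Rightarrow> 'r::idom"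
  assumes sums: "\<And>M. M \<in> Lat \<Longrightarrow> idx M = p * n \<Longrightarrow>
      (\<Sum>K\<in>{K \<in> Lat. M \<subseteq> K \<and> idx K = n}. b K ^ p) = 0"
    and "L \<in> Lat" "idx L = n"
  shows "b L = 0"
  using \<open>L \<in> Lat\<close> \<open>idx L = n\<close>
proof (induction "fst_exp L" arbitrary: L rule: less_induct)
  case less
  obtain M where M: "M \<in> Lat" "M \<subseteq> L" "idx M = idx L * p"
    and smaller: "\<And>K. K \<in> Lat \<Longrightarrow> M \<subseteq> K \<Longrightarrow> idx K = idx L \<Longrightarrow> K \<noteq> L \<Longrightarrow> fst_exp K < fst_exp L"
    using triangular_sublattice[OF less.prems(1)] by metis
  let ?S = "{K \<in> Lat. M \<subseteq> K \<and> idx K = n}"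
  have "finite ?S" by (rule finite_subset[OF _ finite_supLat[OF M(1)]]) auto
  moreover have "L \<in> ?S" using less.prems M by simp
  moreover have "b K ^ p = 0" if "K \<in> ?S - {L}" for K
    using that less smaller[of K] p_gt_0 by simp
  then have "(\<Sum>K\<in>?S - {L}. b K ^ p) = 0" by (intro sum.neutral ballI)
  ultimately have "(\<Sum>K\<in>?S. b K ^ p) = b L ^ p"
    by (simp add: sum.remove[of _ L])
  then show ?case using sums[OF M(1)] M(3) less.prems(2) by (simp add: mult.commute)
qed

section \<open>The topological group of pairs of p-adic integers\<close>

abbreviation "G \<equiv> Zp2 p"
abbreviation "\<tau> \<equiv> Zp2_topology p"

lemma carrier_Zp_iff: "x \<in> carrier (Zp p) \<longleftrightarrow>
    (\<forall>n. 0 \<le> x n \<and> x n < int p ^ n \<and> x (Suc n) mod int p ^ n = x n)"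
  by (simp add: Zp_def)

lemma mult_Zp: "(x \<otimes>\<^bsub>Zp p\<^esub> y) n = (x n + y n) mod int p ^ n"
  by (simp add: Zp_def)

lemma one_Zp: "\<one>\<^bsub>Zp p\<^esub> = (\<lambda>n. 0)"
  by (simp add: Zp_def)

lemma power_mod_Suc: "x mod int p ^ Suc n mod int p ^ n = x mod int p ^ n"
  by (simp add: mod_mod_cancel)

lemma group_Zp: "group (Zp p)"
proof (rule groupI)
  fix x y assume xy: "x \<in> carrier (Zp p)" "y \<in> carrier (Zp p)"
  have "(x (Suc n) + y (Suc n)) mod int p ^ Suc n mod int p ^ n = (x n + y n) mod int p ^ n"
    for n
  proof -
    have "(x (Suc n) + y (Suc n)) mod int p ^ n =
        (x (Suc n) mod int p ^ n + y (Suc n) mod int p ^ n) mod int p ^ n"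
      by (simp add: mod_add_eq)
    then show ?thesis using xy by (simp only: power_mod_Suc carrier_Zp_iff)
  qed
  then show "x \<otimes>\<^bsub>Zp p\<^esub> y \<in> carrier (Zp p)"
    using p_gt_0 unfolding carrier_Zp_iff mult_Zp by simp
next
  fix x assume x: "x \<in> carrier (Zp p)"
  have "(- x (Suc n)) mod int p ^ Suc n mod int p ^ n = (- x n) mod int p ^ n" for n
  proof -
    have "(- x (Suc n)) mod int p ^ n = (- (x (Suc n) mod int p ^ n)) mod int p ^ n"
      by (simp add: mod_minus_eq)
    then show ?thesis using x by (simp only: power_mod_Suc carrier_Zp_iff)
  qed
  then have "(\<lambda>n. (- x n) mod int p ^ n) \<in> carrier (Zp p)"
    using p_gt_0 unfolding carrier_Zp_iff by simp
  moreover have "(\<lambda>n. (- x n) mod int p ^ n) \<otimes>\<^bsub>Zp p\<^esub> x = \<one>\<^bsub>Zp p\<^esub>"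
    by (rule ext) (simp add: mult_Zp one_Zp mod_add_left_eq)
  ultimately show "\<exists>y\<in>carrier (Zp p). y \<otimes>\<^bsub>Zp p\<^esub> x = \<one>\<^bsub>Zp p\<^esub>" by blast
  show "\<one>\<^bsub>Zp p\<^esub> \<otimes>\<^bsub>Zp p\<^esub> x = x"
    using x by (auto simp: mult_Zp one_Zp carrier_Zp_iff)
qed (use p_gt_0 in \<open>auto simp: fun_eq_iff mult_Zp one_Zp carrier_Zp_iff mod_add_left_eq
    mod_add_right_eq add.assoc\<close>)

lemma group_Zp2: "group G"
  unfolding Zp2_def by (intro DirProd_group group_Zp)

lemma topspace_Zp: "topspace (Zp_topology p) = carrier (Zp p)"
  by (auto simp: Zp_topology_def)

lemma topspace_Zp2: "topspace \<tau> = carrier G"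
  by (simp add: Zp2_topology_def Zp2_def topspace_Zp)

text \<open>
  The dense embedding of \<open>\<int>\<^sup>2\<close> into \<open>\<int>\<^sub>p\<^sup>2\<close>.
\<close>

definition emb :: "int \<times> int \<Rightarrow> (nat \<Rightarrow> int) \<times> (nat \<Rightarrow> int)" where
  "emb z = (\<lambda>n. fst z mod int p ^ n, \<lambda>n. snd z mod int p ^ n)"

definition trunc :: "nat \<Rightarrow> (nat \<Rightarrow> int) \<times> (nat \<Rightarrow> int) \<Rightarrow> int \<times> int" where
  "trunc N g = (fst g N, snd g N)"

lemma emb_carrier: "emb z \<in> carrier G"
  using p_gt_0 by (simp add: emb_def Zp2_def carrier_Zp_iff power_mod_Suc del: power_Suc)

lemma emb_add: "emb (x + y) = emb x \<otimes>\<^bsub>G\<^esub> emb y"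
  by (simp add: emb_def Zp2_def fun_eq_iff mult_Zp mod_add_eq)

lemma emb_zero: "emb 0 = \<one>\<^bsub>G\<^esub>"
  by (simp add: emb_def Zp2_def one_Zp)

lemma trunc_emb: "trunc N (emb z) = reduce N z"
  by (simp add: trunc_def emb_def reduce_def)

lemma trunc_mult: "trunc N (g \<otimes>\<^bsub>G\<^esub> h) = reduce N (trunc N g + trunc N h)"
  by (simp add: trunc_def Zp2_def mult_DirProd' mult_Zp reduce_def)

lemma Zp_eq_mod:
  assumes x: "x \<in> carrier (Zp p)"
  shows "n \<le> N \<Longrightarrow> x n = x N mod int p ^ n"
proof (induction N rule: dec_induct)
  case base
  show ?case using x by (simp add: carrier_Zp_iff)
next
  case (step N)
  have "x (Suc N) mod int p ^ n = x (Suc N) mod int p ^ N mod int p ^ n"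
    using step(1) by (simp add: mod_mod_cancel le_imp_power_dvd)
  also have "x (Suc N) mod int p ^ N = x N" using x by (simp add: carrier_Zp_iff)
  finally show ?case using step(3) by simp
qed

lemma trunc_zero_mono:
  assumes "g \<in> carrier G" "trunc M g = 0" "N \<le> M"
  shows "trunc N g = 0"
proof -
  have "fst g \<in> carrier (Zp p)" "snd g \<in> carrier (Zp p)"
    using assms(1) by (auto simp: Zp2_def)
  then have "fst g N = fst g M mod int p ^ N" "snd g N = snd g M mod int p ^ N"
    using Zp_eq_mod[of "fst g" N M] Zp_eq_mod[of "snd g" N M] assms(3) by blast+
  then show ?thesis using assms(2) by (simp add: trunc_def zero_prod_def)
qed

text \<open>
  A basic open neighbourhood restricts finitely many coordinates, and a coordinate of a \<open>p\<close>-adic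
  integer determines all earlier ones.
\<close>

lemma open_Zp_contains:
  assumes U: "openin (Zp_topology p) U" and zero: "(\<lambda>n. 0) \<in> U"
  obtains N where "\<And>x. x \<in> carrier (Zp p) \<Longrightarrow> x N = 0 \<Longrightarrow> x \<in> U"
proof -
  obtain T where T: "openin (product_topology (\<lambda>n::nat. discrete_topology (UNIV :: int set)) UNIV) T"
      and UT: "U = T \<inter> carrier (Zp p)"
    using U by (auto simp: Zp_topology_def openin_subtopology)
  obtain V where V: "finite {i::nat. V i \<noteq> (UNIV :: int set)}" "(\<lambda>n. 0) \<in> Pi\<^sub>E UNIV V"
      "Pi\<^sub>E UNIV V \<subseteq> T"
    using product_topology_open_contains_basis[OF T, of "\<lambda>n. 0"] zero UT by auto
  obtain N where "\<forall>i\<in>{i. V i \<noteq> UNIV}. i \<le> N"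
    using V(1) unfolding finite_nat_set_iff_bounded_le by blast
  then have N: "i \<le> N" if "V i \<noteq> UNIV" for i using that by blast
  show ?thesis
  proof (rule that)
    fix x assume x: "x \<in> carrier (Zp p)" "x N = 0"
    have "x n \<in> V n" for n
    proof (cases "V n = UNIV")
      case False
      then have "x n = 0" using Zp_eq_mod[OF x(1) N] x(2) by simp
      then show ?thesis using V(2) by (auto simp: PiE_iff)
    qed simp
    then have "x \<in> Pi\<^sub>E UNIV V" by (simp add: PiE_iff)
    then show "x \<in> U" using V(3) UT x(1) by blast
  qed
qed

lemma open_Zp2_contains:
  assumes U: "openin \<tau> U" and one: "\<one>\<^bsub>G\<^esub> \<in> U"
  obtains N where "\<And>g. g \<in> carrier G \<Longrightarrow> trunc N g = 0 \<Longrightarrow> g \<in> U"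
proof -
  let ?z = "\<lambda>n::nat. 0 :: int"
  have "(?z, ?z) \<in> U" using one by (simp add: Zp2_def one_Zp)
  moreover have "\<forall>x y. (x, y) \<in> U \<longrightarrow> (\<exists>A B. openin (Zp_topology p) A \<and>
      openin (Zp_topology p) B \<and> x \<in> A \<and> y \<in> B \<and> A \<times> B \<subseteq> U)"
    using U by (simp only: Zp2_topology_def openin_prod_topology_alt)
  ultimately have "\<exists>A B. openin (Zp_topology p) A \<and>
      openin (Zp_topology p) B \<and> ?z \<in> A \<and> ?z \<in> B \<and> A \<times> B \<subseteq> U"
    by (elim allE impE)
  then obtain A B where A: "openin (Zp_topology p) A" "?z \<in> A"
    and B: "openin (Zp_topology p) B" "?z \<in> B" and AB: "A \<times> B \<subseteq> U"
    by (elim exE conjE)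
  obtain M where M: "\<And>x. x \<in> carrier (Zp p) \<Longrightarrow> x M = 0 \<Longrightarrow> x \<in> A"
    using open_Zp_contains[OF A] by blast
  obtain N where N: "\<And>x. x \<in> carrier (Zp p) \<Longrightarrow> x N = 0 \<Longrightarrow> x \<in> B"
    using open_Zp_contains[OF B] by blast
  show ?thesis
  proof (rule that)
    fix g assume g: "g \<in> carrier G" "trunc (max M N) g = 0"
    then have "trunc M g = 0" "trunc N g = 0" using trunc_zero_mono by auto
    then have "fst g \<in> A" "snd g \<in> B"
      using g(1) M N by (auto simp: trunc_def zero_prod_def Zp2_def)
    then show "g \<in> U" using AB by (metis mem_Sigma_iff prod.collapse subsetD)
  qed
qed

section \<open>Finite transitive sets and their stabilizers\<close>

text \<open>
  The kernel of the action of \<open>\<int>\<^sup>2\<close>. As the group is commutative and the action is transitive, it is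
  also the stabilizer of each single point (\<open>stabI\<close>).
\<close>

definition stab :: "Zp2_set \<Rightarrow> (int \<times> int) set" where
  "stab X = {z. \<forall>x\<in>fst X. snd X (emb z) x = x}"

context
  fixes X :: "Zp2_set"
  assumes X: "fin_trans_gset G \<tau> X"
begin

lemma gset_action: "group_action G (fst X) (snd X)"
  using X by (simp add: fin_trans_gset_def transitive_action_def)

lemma gset_finite: "finite (fst X)" "fst X \<noteq> {}"
  using X by (simp_all add: fin_trans_gset_def)

lemma act_closed: "x \<in> fst X \<Longrightarrow> snd X (emb z) x \<in> fst X"
  using group_action.element_image[OF gset_action emb_carrier] by blast

lemma act_mult:
  "x \<in> fst X \<Longrightarrow> g \<in> carrier G \<Longrightarrow> h \<in> carrier G \<Longrightarrow>
    snd X (g \<otimes>\<^bsub>G\<^esub> h) x = snd X g (snd X h x)"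
  by (rule group_action.composition_rule[OF gset_action])

lemma act_add: "x \<in> fst X \<Longrightarrow> snd X (emb (a + b)) x = snd X (emb a) (snd X (emb b) x)"
  by (simp add: emb_add act_mult emb_carrier)

lemma act_one: "x \<in> fst X \<Longrightarrow> snd X \<one>\<^bsub>G\<^esub> x = x"
  by (metis group_action.id_eq_one[OF gset_action] restrict_apply')

lemma act_zero: "x \<in> fst X \<Longrightarrow> snd X (emb 0) x = x"
  by (simp add: emb_zero act_one)

text \<open>
  By continuity each of the finitely many points is fixed by a neighbourhood of the neutral element.
  Hence the action factors through the residues modulo some \<open>p ^ N\<close>, on which \<open>\<int>\<^sup>2\<close> maps onto; this
  is what allows the \<open>p\<close>-adic group to be replaced by \<open>\<int>\<^sup>2\<close>.
\<close>

lemma gset_level: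
  obtains N where "\<And>M g x. N \<le> M \<Longrightarrow> g \<in> carrier G \<Longrightarrow> x \<in> fst X \<Longrightarrow>
    snd X g x = snd X (emb (trunc M g)) x"
proof -
  have "\<exists>N. \<forall>g\<in>carrier G. trunc N g = 0 \<longrightarrow> snd X g x = x" if x: "x \<in> fst X" for x
  proof -
    have "continuous_map \<tau> (prod_topology \<tau> (discrete_topology (fst X))) (\<lambda>g. (g, x))"
      using x by (intro continuous_map_pairedI) auto
    moreover have "continuous_map (prod_topology \<tau> (discrete_topology (fst X)))
        (discrete_topology (fst X)) (\<lambda>(g, x). snd X g x)"
      using X by (simp add: fin_trans_gset_def)
    ultimately have "continuous_map \<tau> (discrete_topology (fst X))
        ((\<lambda>(g, x). snd X g x) \<circ> (\<lambda>g. (g, x)))"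
      by (rule continuous_map_compose)
    then have "openin \<tau> {g \<in> topspace \<tau>. ((\<lambda>(g, x). snd X g x) \<circ> (\<lambda>g. (g, x))) g \<in> {x}}"
      by (rule openin_continuous_map_preimage) (use x in simp)
    then have "openin \<tau> {g \<in> carrier G. snd X g x = x}" by (simp add: topspace_Zp2)
    moreover have "\<one>\<^bsub>G\<^esub> \<in> {g \<in> carrier G. snd X g x = x}"
      using x act_one group.is_monoid[OF group_Zp2] by (simp add: monoid.one_closed)
    ultimately obtain N where
      "\<And>g. g \<in> carrier G \<Longrightarrow> trunc N g = 0 \<Longrightarrow> g \<in> {g \<in> carrier G. snd X g x = x}"
      by (rule open_Zp2_contains) blast
    then show ?thesis by blast
  qed
  then obtain n where n: "\<And>x g. x \<in> fst X \<Longrightarrow> g \<in> carrier G \<Longrightarrow> trunc (n x) g = 0 \<Longrightarrow> snd X g x = x"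
    by metis
  define N where "N = Max (n ` fst X)"
  show ?thesis
  proof (rule that)
    fix M g x assume M: "N \<le> M" and g: "g \<in> carrier G" and x: "x \<in> fst X"
    define h where "h = emb (- trunc M g) \<otimes>\<^bsub>G\<^esub> g"
    have h: "h \<in> carrier G"
      unfolding h_def using g emb_carrier group.is_monoid[OF group_Zp2] by (simp add: monoid.m_closed)
    have "emb (trunc M g) \<otimes>\<^bsub>G\<^esub> h = emb (trunc M g + - trunc M g) \<otimes>\<^bsub>G\<^esub> g"
      unfolding h_def emb_add using g emb_carrier group.is_monoid[OF group_Zp2]
      by (simp add: monoid.m_assoc)
    also have "\<dots> = g" using g group.is_monoid[OF group_Zp2] by (simp add: emb_zero)
    finally have g_eq: "g = emb (trunc M g) \<otimes>\<^bsub>G\<^esub> h" by simp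
    have "trunc M h = reduce M (reduce M (- trunc M g) + trunc M g)"
      by (simp add: h_def trunc_mult trunc_emb)
    then have "trunc M h = 0" by (simp add: reduce_add_left) (simp add: reduce_def zero_prod_def)
    moreover have "n x \<le> M" using M x gset_finite unfolding N_def by simp
    ultimately have "snd X h x = x" using n[OF x h] trunc_zero_mono[OF h] by blast
    then show "snd X g x = snd X (emb (trunc M g)) x"
      using act_mult[OF x emb_carrier h, of "trunc M g"] g_eq by simp
  qed
qed

lemma act_transitive:
  assumes "x \<in> fst X" "y \<in> fst X"
  obtains z where "snd X (emb z) x = y"
proof -
  have "transitive_action G (fst X) (snd X)" using X by (simp add: fin_trans_gset_def)
  then obtain g where "g \<in> carrier G" "snd X g x = y"
    using transitive_action.unique_orbit assms by metis
  then show ?thesis using gset_level that assms by (metis order_refl)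
qed

lemma stabI:
  assumes x: "x \<in> fst X" and z: "snd X (emb z) x = x"
  shows "z \<in> stab X"
  unfolding stab_def
proof (intro CollectI ballI)
  fix y assume "y \<in> fst X"
  then obtain w where w: "snd X (emb w) x = y" using act_transitive x by blast
  have "snd X (emb z) y = snd X (emb (z + w)) x" using x by (simp add: act_add w)
  also have "\<dots> = snd X (emb (w + z)) x" by (simp add: add.commute)
  also have "\<dots> = y" using x by (simp add: act_add z w)
  finally show "snd X (emb z) y = y" .
qed

lemma act_eq_iff:
  assumes x: "x \<in> fst X"
  shows "snd X (emb a) x = snd X (emb b) x \<longleftrightarrow> a - b \<in> stab X"
proof -
  have eq: "snd X (emb a) x = snd X (emb (a - b)) (snd X (emb b) x)"
    using act_add[OF x, of "a - b" b] by simp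
  show ?thesis
  proof
    assume "snd X (emb a) x = snd X (emb b) x"
    then show "a - b \<in> stab X" using eq x by (intro stabI[of "snd X (emb b) x"] act_closed) auto
  next
    assume "a - b \<in> stab X"
    then show "snd X (emb a) x = snd X (emb b) x"
      using act_closed[OF x] by (simp add: eq stab_def)
  qed
qed

lemma stab_Lat: "stab X \<in> Lat"
proof -
  obtain N where N: "\<And>M g x. N \<le> M \<Longrightarrow> g \<in> carrier G \<Longrightarrow> x \<in> fst X \<Longrightarrow>
    snd X g x = snd X (emb (trunc M g)) x" using gset_level by blast
  obtain x where x: "x \<in> fst X" using gset_finite by blast
  show ?thesis
  proof (rule LatI)
    show "0 \<in> stab X" by (simp add: stab_def act_zero)
    show "has_level (stab X) N"
      unfolding has_level_def
    proof
      fix z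
      have "reduce N (scale (int p ^ N) z) = 0"
        by (simp add: reduce_def scale_def zero_prod_def)
      then show "scale (int p ^ N) z \<in> stab X"
        using N[OF order_refl emb_carrier x, of "scale (int p ^ N) z"] x
        by (intro stabI[OF x]) (simp add: trunc_emb act_zero)
    qed
    fix a b assume "a \<in> stab X" "b \<in> stab X"
    then have "snd X (emb a) x = snd X (emb b) x" using x by (simp add: stab_def)
    then show "a - b \<in> stab X" by (simp add: act_eq_iff[OF x])
  qed
qed

lemma card_gset: "card (fst X) = idx (stab X)"
proof -
  obtain x where x: "x \<in> fst X" using gset_finite by blast
  define f where "f C = snd X (emb (SOME z. coset (stab X) z = C)) x" for C
  have f: "f (coset (stab X) z) = snd X (emb z) x" for z
  proof -
    have "coset (stab X) (SOME w. coset (stab X) w = coset (stab X) z) = coset (stab X) z"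
      by (rule someI) (rule refl)
    then show ?thesis by (simp add: f_def act_eq_iff[OF x] coset_eq_iff[OF stab_Lat])
  qed
  have "inj_on f (range (coset (stab X)))"
    by (auto simp: inj_on_def f act_eq_iff[OF x] coset_eq_iff[OF stab_Lat])
  moreover have "f ` range (coset (stab X)) = fst X"
  proof
    show "f ` range (coset (stab X)) \<subseteq> fst X" using x by (auto simp: f act_closed)
    show "fst X \<subseteq> f ` range (coset (stab X))"
    proof
      fix y assume "y \<in> fst X"
      then obtain z where "snd X (emb z) x = y" using act_transitive x by blast
      then show "y \<in> f ` range (coset (stab X))" by (auto simp flip: f)
    qed
  qed
  ultimately show ?thesis unfolding idx_def using card_image by metis
qed

end

context
  fixes X Y :: "Zp2_set"
  assumes X: "fin_trans_gset G \<tau> X" and Y: "fin_trans_gset G \<tau> Y"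
begin

lemma gmaps_closed: "f \<in> gmaps G X Y \<Longrightarrow> x \<in> fst X \<Longrightarrow> f x \<in> fst Y"
  by (auto simp: gmaps_def)

lemma gmaps_act:
  "f \<in> gmaps G X Y \<Longrightarrow> x \<in> fst X \<Longrightarrow> f (snd X (emb z) x) = snd Y (emb z) (f x)"
  using emb_carrier[of z] by (simp add: gmaps_def)

text \<open>
  Equivariance under \<open>\<int>\<^sup>2\<close> suffices, because at a common level both actions depend on residues only.
\<close>

lemma gmapsI:
  assumes f: "f \<in> fst X \<rightarrow>\<^sub>E fst Y"
    and act: "\<And>z x. x \<in> fst X \<Longrightarrow> f (snd X (emb z) x) = snd Y (emb z) (f x)"
  shows "f \<in> gmaps G X Y"
proof -
  obtain M where M: "\<And>K g x. M \<le> K \<Longrightarrow> g \<in> carrier G \<Longrightarrow> x \<in> fst X \<Longrightarrow>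
    snd X g x = snd X (emb (trunc K g)) x" using gset_level[OF X] by blast
  obtain N where N: "\<And>K g x. N \<le> K \<Longrightarrow> g \<in> carrier G \<Longrightarrow> x \<in> fst Y \<Longrightarrow>
    snd Y g x = snd Y (emb (trunc K g)) x" using gset_level[OF Y] by blast
  have "f (snd X g x) = snd Y g (f x)" if g: "g \<in> carrier G" and x: "x \<in> fst X" for g x
  proof -
    have "f x \<in> fst Y" using f x by auto
    then show ?thesis using g x act by (simp add: M[of "max M N"] N[of "max M N"])
  qed
  then show ?thesis using f by (simp add: gmaps_def)
qed

lemma gmaps_stab:
  assumes "f \<in> gmaps G X Y"
  shows "stab X \<subseteq> stab Y"
proof
  fix z assume z: "z \<in> stab X"
  obtain x where x: "x \<in> fst X" using gset_finite[OF X] by blast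
  have "snd Y (emb z) (f x) = f (snd X (emb z) x)" using assms x by (simp add: gmaps_act)
  also have "\<dots> = f x" using z x by (simp add: stab_def)
  finally show "z \<in> stab Y" by (rule stabI[OF Y gmaps_closed[OF assms x]])
qed

text \<open>
  An equivariant map is determined by the image of one point \<open>x\<close>, and the image may be any point,
  since what fixes \<open>x\<close> fixes every point of \<open>Y\<close>.
\<close>

lemma gmaps_determined:
  assumes sub: "stab X \<subseteq> stab Y" and x: "x \<in> fst X"
  shows "bij_betw (\<lambda>f. f x) (gmaps G X Y) (fst Y)"
  unfolding bij_betw_def
proof
  show "inj_on (\<lambda>f. f x) (gmaps G X Y)"
  proof (rule inj_onI)
    fix f g assume fg: "f \<in> gmaps G X Y" "g \<in> gmaps G X Y" "f x = g x"
    show "f = g"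
    proof (rule PiE_ext[of f _ _ g])
      show "f \<in> fst X \<rightarrow>\<^sub>E fst Y" "g \<in> fst X \<rightarrow>\<^sub>E fst Y" using fg by (simp_all add: gmaps_def)
      fix y assume "y \<in> fst X"
      then obtain z where "snd X (emb z) x = y" using act_transitive[OF X x] by blast
      then show "f y = g y"
        using gmaps_act[OF fg(1) x, of z] gmaps_act[OF fg(2) x, of z] fg(3) by simp
    qed
  qed
  show "(\<lambda>f. f x) ` gmaps G X Y = fst Y"
  proof
    show "(\<lambda>f. f x) ` gmaps G X Y \<subseteq> fst Y" using x gmaps_closed by auto
    show "fst Y \<subseteq> (\<lambda>f. f x) ` gmaps G X Y"
    proof
      fix y assume y: "y \<in> fst Y"
      define f where "f = (\<lambda>u\<in>fst X. snd Y (emb (SOME z. snd X (emb z) x = u)) y)"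
      have f: "f (snd X (emb z) x) = snd Y (emb z) y" for z
      proof -
        have "snd X (emb (SOME w. snd X (emb w) x = snd X (emb z) x)) x = snd X (emb z) x"
          by (rule someI) (rule refl)
        then have "snd Y (emb (SOME w. snd X (emb w) x = snd X (emb z) x)) y = snd Y (emb z) y"
          using sub by (auto simp: act_eq_iff[OF X x] act_eq_iff[OF Y y])
        then show ?thesis using act_closed[OF X x] by (simp add: f_def)
      qed
      have "f \<in> gmaps G X Y"
      proof (rule gmapsI)
        show "f \<in> fst X \<rightarrow>\<^sub>E fst Y" using y by (auto simp: f_def act_closed[OF Y])
        fix z u assume "u \<in> fst X"
        then obtain w where w: "u = snd X (emb w) x" using act_transitive[OF X x] by metis
        then have "snd X (emb z) u = snd X (emb (z + w)) x" using x by (simp add: act_add[OF X])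
        then show "f (snd X (emb z) u) = snd Y (emb z) (f u)"
          using y by (simp only: f w act_add[OF Y])
      qed
      moreover have "f x = y" using f[of 0] x y by (simp add: act_zero[OF X] act_zero[OF Y])
      ultimately show "y \<in> (\<lambda>f. f x) ` gmaps G X Y" by blast
    qed
  qed
qed

lemma gmaps_nonempty_iff: "gmaps G X Y \<noteq> {} \<longleftrightarrow> stab X \<subseteq> stab Y"
proof
  assume "stab X \<subseteq> stab Y"
  moreover obtain x where "x \<in> fst X" using gset_finite[OF X] by blast
  ultimately have "bij_betw (\<lambda>f. f x) (gmaps G X Y) (fst Y)" by (rule gmaps_determined)
  then show "gmaps G X Y \<noteq> {}" using gset_finite[OF Y] by (auto simp: bij_betw_def)
qed (use gmaps_stab in blast)

lemma card_gmaps: "stab X \<subseteq> stab Y \<Longrightarrow> card (gmaps G X Y) = idx (stab Y)"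
  using gmaps_determined bij_betw_same_card gset_finite[OF X] card_gset[OF Y] by (metis ex_in_conv)

lemma gset_iso_iff: "(X, Y) \<in> gset_iso G \<tau> \<longleftrightarrow> stab X = stab Y"
proof
  assume "(X, Y) \<in> gset_iso G \<tau>"
  then obtain f where f: "f \<in> gmaps G X Y" "bij_betw f (fst X) (fst Y)"
    by (auto simp: gset_iso_def)
  have "idx (stab X) = idx (stab Y)"
    using bij_betw_same_card[OF f(2)] card_gset X Y by metis
  then show "stab X = stab Y"
    using gmaps_stab[OF f(1)] stab_Lat X Y by (intro idx_eq_imp_eq) auto
next
  assume eq: "stab X = stab Y"
  then obtain f where f: "f \<in> gmaps G X Y" using gmaps_nonempty_iff by blast
  have "f ` fst X = fst Y"
  proof
    show "f ` fst X \<subseteq> fst Y" using f gmaps_closed by auto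
    obtain x where x: "x \<in> fst X" using gset_finite[OF X] by blast
    show "fst Y \<subseteq> f ` fst X"
    proof
      fix y assume "y \<in> fst Y"
      moreover have "f x \<in> fst Y" using f x by (rule gmaps_closed)
      ultimately obtain z where "snd Y (emb z) (f x) = y" using act_transitive[OF Y] by blast
      then have "y = f (snd X (emb z) x)" using f x by (simp add: gmaps_act)
      then show "y \<in> f ` fst X" using act_closed[OF X x] by blast
    qed
  qed
  moreover have "card (fst X) = card (fst Y)" using eq card_gset X Y by metis
  ultimately have "bij_betw f (fst X) (fst Y)"
    using gset_finite[OF X] by (simp add: bij_betw_def eq_card_imp_inj_on)
  then show "(X, Y) \<in> gset_iso G \<tau>" using f X Y by (auto simp: gset_iso_def)
qed

end

text \<open>
  The required set consists of the cosets of \<open>L\<close>, numbered by natural numbers; a pair of \<open>p\<close>-adic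
  integers acts by translation with its residue modulo \<open>p ^ N\<close>, where \<open>N\<close> is a level of \<open>L\<close>.
\<close>

lemma ex_gset_stab:
  assumes L: "L \<in> Lat"
  obtains X where "fin_trans_gset G \<tau> X" "stab X = L"
proof -
  obtain N where N: "has_level L N" using Lat_level[OF L] by blast
  define S where "S = {0..<idx L}"
  obtain h where h: "bij_betw h (range (coset L)) S"
    unfolding S_def idx_def using ex_bij_betw_finite_nat[OF finite_range_coset[OF L]] by blast
  define e where "e z = h (coset L z)" for z
  have e_eq: "e a = e b \<longleftrightarrow> a - b \<in> L" for a b
    unfolding e_def coset_eq_iff[OF L, symmetric] using h
    by (auto simp: bij_betw_def dest: inj_onD)
  have e_in: "e z \<in> S" for z using h by (auto simp: e_def bij_betw_def)
  define r where "r x = (SOME z. e z = x)" for x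
  have e_r: "e (r x) = x" if x: "x \<in> S" for x
  proof -
    have "\<exists>z. e z = x" using h x by (auto simp: e_def bij_betw_def)
    then show ?thesis unfolding r_def by (rule someI_ex)
  qed
  have e_shift: "e (t + r (e z)) = e (t + z)" for t z
    using e_r[OF e_in, of z] by (simp add: e_eq)
  have e_reduce: "e (reduce N w + z) = e (w + z)" for w z
    using N by (simp add: e_eq reduce_eq has_level_def Lat_scale[OF L])
      (metis Lat_diff[OF L] Lat_zero[OF L] diff_0)
  define act where "act g = (\<lambda>x\<in>S. e (trunc N g + r x))" for g
  have act_e: "act g (e z) = e (trunc N g + z)" for g z
    using e_in by (simp add: act_def e_shift)
  have S_cases: "\<exists>z. x = e z" if "x \<in> S" for x using e_r[OF that] by metis
  have act_Bij: "act g \<in> Bij S" for g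
  proof -
    have "act g ` S \<subseteq> S" by (auto simp: act_def intro: e_in)
    moreover have "inj_on (act g) S"
    proof (rule inj_onI)
      fix x y assume xy: "x \<in> S" "y \<in> S" "act g x = act g y"
      obtain a where "x = e a" using S_cases xy(1) by blast
      moreover obtain b where "y = e b" using S_cases xy(2) by blast
      ultimately show "x = y" using xy(3) by (simp add: act_e e_eq)
    qed
    ultimately have "bij_betw (act g) S S"
      by (simp add: bij_betw_def endo_inj_surj S_def)
    then show ?thesis by (simp add: Bij_def act_def)
  qed
  have act_mult: "act (g \<otimes>\<^bsub>G\<^esub> k) = compose S (act g) (act k)" for g k
  proof
    fix x
    show "act (g \<otimes>\<^bsub>G\<^esub> k) x = compose S (act g) (act k) x"
    proof (cases "x \<in> S")
      case True
      then obtain z where z: "x = e z" using S_cases by blast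
      show ?thesis using True by (simp add: compose_def z act_e trunc_mult e_reduce add.assoc)
    qed (simp add: act_def compose_def)
  qed
  have "group_hom G (BijGroup S) act"
    using group_Zp2 group_BijGroup act_Bij act_mult
    by (auto simp: group_hom_def group_hom_axioms_def hom_def BijGroup_def)
  then have action: "group_action G S act" by (simp add: group_action_def)
  have trans: "transitive_action G S act"
    unfolding transitive_action_def transitive_action_axioms_def
  proof (intro conjI action allI impI)
    fix x y assume "x \<in> S" "y \<in> S"
    then obtain a b where "x = e a" "y = e b" using S_cases by metis
    then have "act (emb (b - a)) x = y" by (simp add: act_e trunc_emb e_reduce)
    then show "\<exists>g\<in>carrier G. act g x = y" using emb_carrier by blast
  qed
  let ?D = "prod_topology (discrete_topology (UNIV :: (int \<times> int) set)) (discrete_topology S)"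
  have proj: "continuous_map (Zp_topology p) (discrete_topology UNIV) (\<lambda>x. x N)"
    unfolding Zp_topology_def
    by (intro continuous_map_from_subtopology continuous_map_product_projection) simp
  have "continuous_map \<tau> (prod_topology (discrete_topology UNIV) (discrete_topology UNIV)) (trunc N)"
    unfolding Zp2_topology_def trunc_def
    by (intro continuous_map_pairedI continuous_map_compose[OF continuous_map_fst proj, unfolded o_def]
        continuous_map_compose[OF continuous_map_snd proj, unfolded o_def])
  then have "continuous_map \<tau> (discrete_topology UNIV) (trunc N)"
    by (simp flip: prod_topology_discrete_topology)
  then have "continuous_map (prod_topology \<tau> (discrete_topology S)) ?D (\<lambda>(g, x). (trunc N g, x))"
    unfolding continuous_map_prod_top by simp
  moreover have "continuous_map ?D (discrete_topology S) (\<lambda>(t, x). e (t + r x))"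
    unfolding prod_topology_discrete_topology[symmetric] by (auto intro: e_in)
  ultimately have "continuous_map (prod_topology \<tau> (discrete_topology S)) (discrete_topology S)
      ((\<lambda>(t, x). e (t + r x)) \<circ> (\<lambda>(g, x). (trunc N g, x)))"
    by (rule continuous_map_compose)
  then have cont: "continuous_map (prod_topology \<tau> (discrete_topology S)) (discrete_topology S)
      (\<lambda>(g, x). act g x)"
    by (rule continuous_map_eq) (auto simp: act_def)
  have "fin_trans_gset G \<tau> (S, act)"
    using trans cont idx_pos[OF L] by (simp add: fin_trans_gset_def S_def)
  moreover have "stab (S, act) = L"
  proof -
    have "act (emb z) (e w) = e w \<longleftrightarrow> z \<in> L" for z w
      by (simp add: act_e trunc_emb e_reduce e_eq)
    then show ?thesis using S_cases e_in by (fastforce simp: stab_def)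
  qed
  ultimately show ?thesis by (rule that)
qed

section \<open>Isomorphism classes as plane subgroups\<close>

definition lat :: "Zp2_class \<Rightarrow> (int \<times> int) set" where
  "lat T = stab (rep T)"

lemma gclasses_eq:
  "gclasses G \<tau> = (\<lambda>L. {X. fin_trans_gset G \<tau> X \<and> stab X = L}) ` Lat"
proof -
  have class_eq: "gset_iso G \<tau> `` {X} = {Y. fin_trans_gset G \<tau> Y \<and> stab Y = stab X}"
    if "fin_trans_gset G \<tau> X" for X
    using that gset_iso_iff[OF that] by (auto simp: gset_iso_def)
  show ?thesis
  proof safe
    fix T assume "T \<in> gclasses G \<tau>"
    then obtain X where "fin_trans_gset G \<tau> X" "T = gset_iso G \<tau> `` {X}"
      by (auto simp: gclasses_def elim: quotientE)
    then show "T \<in> (\<lambda>L. {X. fin_trans_gset G \<tau> X \<and> stab X = L}) ` Lat"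
      using class_eq stab_Lat by blast
  next
    fix L assume "L \<in> Lat"
    then obtain X where X: "fin_trans_gset G \<tau> X" "stab X = L" using ex_gset_stab by blast
    then have "{X. fin_trans_gset G \<tau> X \<and> stab X = L} = gset_iso G \<tau> `` {X}"
      using class_eq by simp
    then show "{X. fin_trans_gset G \<tau> X \<and> stab X = L} \<in> gclasses G \<tau>"
      using X by (auto simp: gclasses_def intro: quotientI)
  qed
qed

lemma rep_gclass:
  assumes "T \<in> gclasses G \<tau>"
  shows "fin_trans_gset G \<tau> (rep T)" and "T = {X. fin_trans_gset G \<tau> X \<and> stab X = lat T}"
proof -
  obtain L where L: "L \<in> Lat" and T: "T = {X. fin_trans_gset G \<tau> X \<and> stab X = L}"
    using assms gclasses_eq by blast
  have "\<exists>X. X \<in> T" using ex_gset_stab[OF L] T by blast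
  then have "rep T \<in> T" unfolding rep_def by (rule someI_ex)
  then show "fin_trans_gset G \<tau> (rep T)" "T = {X. fin_trans_gset G \<tau> X \<and> stab X = lat T}"
    using T by (auto simp: lat_def)
qed

lemma lat_Lat: "T \<in> gclasses G \<tau> \<Longrightarrow> lat T \<in> Lat"
  unfolding lat_def by (intro stab_Lat rep_gclass)

lemma bij_betw_lat: "bij_betw lat (gclasses G \<tau>) Lat"
  unfolding bij_betw_def
proof
  show "inj_on lat (gclasses G \<tau>)"
  proof (rule inj_onI)
    fix T U assume TU: "T \<in> gclasses G \<tau>" "U \<in> gclasses G \<tau>" "lat T = lat U"
    have "T = {X. fin_trans_gset G \<tau> X \<and> stab X = lat T}" by (rule rep_gclass(2)[OF TU(1)])
    also have "\<dots> = {X. fin_trans_gset G \<tau> X \<and> stab X = lat U}" by (simp only: TU(3))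
    also have "\<dots> = U" by (rule rep_gclass(2)[OF TU(2), symmetric])
    finally show "T = U" .
  qed
  show "lat ` gclasses G \<tau> = Lat"
  proof
    show "lat ` gclasses G \<tau> \<subseteq> Lat" using lat_Lat by blast
    show "Lat \<subseteq> lat ` gclasses G \<tau>"
    proof
      fix L assume L: "L \<in> Lat"
      define T where "T = {X. fin_trans_gset G \<tau> X \<and> stab X = L}"
      have T: "T \<in> gclasses G \<tau>" using L gclasses_eq by (auto simp: T_def)
      obtain X where "fin_trans_gset G \<tau> X" "stab X = L" using ex_gset_stab[OF L] by blast
      then have "X \<in> T" by (simp add: T_def)
      then have "stab X = lat T" using rep_gclass(2)[OF T] by blast
      then show "L \<in> lat ` gclasses G \<tau>" using T \<open>stab X = L\<close> by blast
    qed
  qed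
qed

definition cls :: "(int \<times> int) set \<Rightarrow> Zp2_class" where
  "cls = inv_into (gclasses G \<tau>) lat"

lemma cls_lat: "T \<in> gclasses G \<tau> \<Longrightarrow> cls (lat T) = T"
  unfolding cls_def using bij_betw_lat by (simp add: bij_betw_def inv_into_f_f)

lemma lat_cls: "L \<in> Lat \<Longrightarrow> lat (cls L) = L"
  unfolding cls_def using bij_betw_lat by (simp add: bij_betw_def f_inv_into_f)

lemma cls_gclass: "L \<in> Lat \<Longrightarrow> cls L \<in> gclasses G \<tau>"
  unfolding cls_def using bij_betw_lat by (simp add: bij_betw_def inv_into_into)

lemma gcard_eq: "T \<in> gclasses G \<tau> \<Longrightarrow> gcard T = idx (lat T)"
  by (simp add: gcard_def lat_def card_gset rep_gclass)

lemma witt_poly_eq_plane_witt: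
  assumes T: "T \<in> gclasses G \<tau>"
  shows "witt_poly G \<tau> T a = plane_witt (lat T) (\<lambda>K. a (cls K))"
proof -
  let ?A = "{U \<in> gclasses G \<tau>. gle G U T}"
  let ?B = "{K \<in> Lat. lat T \<subseteq> K}"
  have le: "gle G U T \<longleftrightarrow> lat T \<subseteq> lat U" if "U \<in> gclasses G \<tau>" for U
    using that T by (simp add: gle_def lat_def gmaps_nonempty_iff rep_gclass)
  have bij: "bij_betw lat ?A ?B"
    using bij_betw_lat le lat_Lat lat_cls cls_gclass
    by (intro bij_betw_byWitness[where f' = cls]) (auto simp: cls_lat)
  have num: "num_gmaps G T U = idx (lat U)" if "U \<in> ?A" for U
    using that le[of U] card_gmaps[OF rep_gclass(1)[OF T] rep_gclass(1)[of U]]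
    by (simp add: num_gmaps_def lat_def)
  let ?f = "\<lambda>K. of_nat (idx K) * a (cls K) ^ (idx (lat T) div idx K)"
  have "witt_poly G \<tau> T a = (\<Sum>U\<in>?A. ?f (lat U))"
    unfolding witt_poly_def
  proof (rule sum.cong[OF refl])
    fix U assume U: "U \<in> ?A"
    then show "of_nat (num_gmaps G T U) * a U ^ (gcard T div gcard U) = ?f (lat U)"
      unfolding num[OF U] using T by (simp add: gcard_eq cls_lat)
  qed
  also have "\<dots> = (\<Sum>K\<in>?B. ?f K)" by (rule sum.reindex_bij_betw[OF bij])
  finally show ?thesis by (simp add: plane_witt_def)
qed

section \<open>The Witt--Burnside ring\<close>

lemma map_witt_poly:
  "unital_ring_map h \<Longrightarrow> h (witt_poly G \<tau> T a) = witt_poly G \<tau> T (\<lambda>U. h (a U))"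
  by (simp add: witt_poly_def unital_ring_map.map_sum unital_ring_map.map_mult
      unital_ring_map.map_of_nat unital_ring_map.map_power)

lemma witt_poly_cong:
  "(\<And>U. U \<in> gclasses G \<tau> \<Longrightarrow> a U = b U) \<Longrightarrow> witt_poly G \<tau> T a = witt_poly G \<tau> T b"
  by (simp add: witt_poly_def)

lemma witt_poly_injective:
  fixes a b :: "Zp2_class \<Rightarrow> 'v zpoly"
  assumes eq: "\<And>T. T \<in> gclasses G \<tau> \<Longrightarrow> witt_poly G \<tau> T a = witt_poly G \<tau> T b"
    and T: "T \<in> gclasses G \<tau>"
  shows "a T = b T"
proof -
  have "plane_witt L (\<lambda>K. a (cls K)) = plane_witt L (\<lambda>K. b (cls K))" if "L \<in> Lat" for L
    using eq[OF cls_gclass[OF that]] that by (simp add: witt_poly_eq_plane_witt cls_gclass lat_cls)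
  then have "a (cls (lat T)) = b (cls (lat T))"
    using lat_Lat[OF T] by (rule plane_witt_injective)
  then show ?thesis using T by (simp add: cls_lat)
qed

text \<open>
  The form of the statement matches the definite descriptions of the families \<open>S\<close> and \<open>M\<close>.
\<close>

lemma ex1_witt_vector:
  fixes w :: "Zp2_class \<Rightarrow> 'v zpoly"
  assumes cong: "\<And>H. H \<in> Lat \<Longrightarrow> burnside_cong (\<lambda>K. w (cls K)) H"
  shows "\<exists>!S. S \<in> extensional (gclasses G \<tau>) \<and> (\<forall>T\<in>gclasses G \<tau>. w T = witt_poly G \<tau> T S)"
proof (rule ex_ex1I)
  obtain s where s: "\<And>H. H \<in> Lat \<Longrightarrow> plane_witt H s = w (cls H)"
    using burnside_cong_imp_plane_witt[OF cong] by blast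
  let ?S = "\<lambda>T\<in>gclasses G \<tau>. s (lat T)"
  have "w T = witt_poly G \<tau> T ?S" if T: "T \<in> gclasses G \<tau>" for T
  proof -
    have "witt_poly G \<tau> T ?S = plane_witt (lat T) s"
      unfolding witt_poly_eq_plane_witt[OF T] by (rule plane_witt_cong) (simp add: cls_gclass lat_cls)
    then show ?thesis using s lat_Lat[OF T] T by (simp add: cls_lat)
  qed
  then show "\<exists>S. S \<in> extensional (gclasses G \<tau>) \<and>
      (\<forall>T\<in>gclasses G \<tau>. w T = witt_poly G \<tau> T S)"
    by (intro exI[of _ ?S]) simp
next
  fix S S'
  assume S: "S \<in> extensional (gclasses G \<tau>) \<and> (\<forall>T\<in>gclasses G \<tau>. w T = witt_poly G \<tau> T S)"
    and S': "S' \<in> extensional (gclasses G \<tau>) \<and> (\<forall>T\<in>gclasses G \<tau>. w T = witt_poly G \<tau> T S')"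
  show "S = S'"
  proof (rule extensionalityI[of _ "gclasses G \<tau>"])
    fix T assume T: "T \<in> gclasses G \<tau>"
    have "witt_poly G \<tau> T S = witt_poly G \<tau> T S'" if T: "T \<in> gclasses G \<tau>" for T
    proof -
      have "w T = witt_poly G \<tau> T S" "w T = witt_poly G \<tau> T S'" using S S' T by blast+
      then show ?thesis by (rule trans[OF sym])
    qed
    then show "S T = S' T" using T by (rule witt_poly_injective)
  qed (use S S' in auto)
qed

lemma burnside_cong_cong:
  fixes H :: "(int \<times> int) set"
  assumes "H \<in> Lat"
    and "\<And>K. K \<in> Lat \<Longrightarrow> v K = w K"
  shows "burnside_cong v H \<longleftrightarrow> burnside_cong w H"
  using assms adjoin_Lat[OF assms(1)] by (simp add: burnside_cong_def)

lemma witt_sum_ghost: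
  assumes "T \<in> gclasses G \<tau>"
  shows "witt_poly G \<tau> T (witt_sum G \<tau>) =
    witt_poly G \<tau> T (\<lambda>U. zvar (Inl U)) + witt_poly G \<tau> T (\<lambda>U. zvar (Inr U))"
proof -
  let ?w = "\<lambda>T. witt_poly G \<tau> T (\<lambda>U. zvar (Inl U)) + witt_poly G \<tau> T (\<lambda>U. zvar (Inr U))"
  have "burnside_cong (\<lambda>K. ?w (cls K)) H" if H: "H \<in> Lat" for H
  proof -
    have "burnside_cong (\<lambda>K. plane_witt K (\<lambda>L. zvar (Inl (cls L))) + plane_witt K (\<lambda>L. zvar (Inr (cls L)))) H"
      by (intro burnside_cong_add burnside_cong_plane_witt H)
    then show ?thesis
      by (subst burnside_cong_cong[OF H])
        (simp_all add: witt_poly_eq_plane_witt cls_gclass lat_cls)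
  qed
  then have "\<exists>!S. S \<in> extensional (gclasses G \<tau>) \<and>
      (\<forall>T\<in>gclasses G \<tau>. ?w T = witt_poly G \<tau> T S)"
    by (rule ex1_witt_vector)
  from theI'[OF this] show ?thesis using assms unfolding witt_sum_def by simp
qed

lemma witt_prod_ghost:
  assumes "T \<in> gclasses G \<tau>"
  shows "witt_poly G \<tau> T (witt_prod G \<tau>) =
    witt_poly G \<tau> T (\<lambda>U. zvar (Inl U)) * witt_poly G \<tau> T (\<lambda>U. zvar (Inr U))"
proof -
  let ?w = "\<lambda>T. witt_poly G \<tau> T (\<lambda>U. zvar (Inl U)) * witt_poly G \<tau> T (\<lambda>U. zvar (Inr U))"
  have "burnside_cong (\<lambda>K. ?w (cls K)) H" if H: "H \<in> Lat" for H
  proof -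
    have "burnside_cong (\<lambda>K. plane_witt K (\<lambda>L. zvar (Inl (cls L))) * plane_witt K (\<lambda>L. zvar (Inr (cls L)))) H"
      by (rule burnside_cong_plane_witt_zvar_mult[OF H])
    then show ?thesis
      by (subst burnside_cong_cong[OF H])
        (simp_all add: witt_poly_eq_plane_witt cls_gclass lat_cls)
  qed
  then have "\<exists>!S. S \<in> extensional (gclasses G \<tau>) \<and>
      (\<forall>T\<in>gclasses G \<tau>. ?w T = witt_poly G \<tau> T S)"
    by (rule ex1_witt_vector)
  from theI'[OF this] show ?thesis using assms unfolding witt_prod_def by simp
qed

text \<open>
  An evaluation of all variables is a ring homomorphism, so that the identities between the universal
  polynomials persist in every ring.
\<close>

lemma zeval_witt_sum_ghost:
  assumes "T \<in> gclasses G \<tau>"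
  shows "witt_poly G \<tau> T (\<lambda>U. zeval (case_sum a b) (witt_sum G \<tau> U)) =
    witt_poly G \<tau> T a + witt_poly G \<tau> T b"
proof -
  interpret e: unital_ring_map "zeval (case_sum a b)" by (rule unital_ring_map_zeval)
  show ?thesis
    by (simp add: map_witt_poly[OF e.unital_ring_map_axioms, symmetric] witt_sum_ghost[OF assms]
        e.map_add) (simp add: map_witt_poly[OF e.unital_ring_map_axioms] zeval_zvar)
qed

lemma zeval_witt_prod_ghost:
  assumes "T \<in> gclasses G \<tau>"
  shows "witt_poly G \<tau> T (\<lambda>U. zeval (case_sum a b) (witt_prod G \<tau> U)) =
    witt_poly G \<tau> T a * witt_poly G \<tau> T b"
proof -
  interpret e: unital_ring_map "zeval (case_sum a b)" by (rule unital_ring_map_zeval)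
  show ?thesis
    by (simp add: map_witt_poly[OF e.unital_ring_map_axioms, symmetric] witt_prod_ghost[OF assms]
        e.map_mult) (simp add: map_witt_poly[OF e.unital_ring_map_axioms] zeval_zvar)
qed

text \<open>
  The substitution of 0 for all variables outside the index set leaves the defining equations of the
  universal polynomials unchanged. By uniqueness it leaves the polynomials unchanged, so they involve
  no such variables. Thus the values of an extensional family outside its domain do not matter.
\<close>

lemma zeval_cong_on_gclasses:
  fixes a b :: "Zp2_class + Zp2_class
    \<Rightarrow> 'r::comm_ring_1"
  assumes F: "F = witt_sum G \<tau> \<or> F = witt_prod G \<tau>"
    and Inl: "\<And>U. U \<in> gclasses G \<tau> \<Longrightarrow> a (Inl U) = b (Inl U)"
    and Inr: "\<And>U. U \<in> gclasses G \<tau> \<Longrightarrow> a (Inr U) = b (Inr U)"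
    and T: "T \<in> gclasses G \<tau>"
  shows "zeval a (F T) = zeval b (F T)"
proof -
  define V where "V = Inl ` gclasses G \<tau> \<union> Inr ` gclasses G \<tau>"
  let ?\<sigma> = "\<lambda>v. if v \<in> V then zvar v else 0"
  interpret \<sigma>: unital_ring_map "zeval ?\<sigma>" by (rule unital_ring_map_zeval)
  have var: "witt_poly G \<tau> T (\<lambda>U. zeval ?\<sigma> (zvar (i U))) = witt_poly G \<tau> T (\<lambda>U. zvar (i U))"
    if "i = Inl \<or> i = Inr" for T i
    using that by (intro witt_poly_cong) (auto simp: zeval_zvar V_def)
  have "witt_poly G \<tau> T (\<lambda>U. zeval ?\<sigma> (F U)) = witt_poly G \<tau> T F" if "T \<in> gclasses G \<tau>" for T
    unfolding map_witt_poly[OF \<sigma>.unital_ring_map_axioms, symmetric]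
    using F that by (elim disjE) (simp_all add: witt_sum_ghost witt_prod_ghost \<sigma>.map_add
      \<sigma>.map_mult map_witt_poly[OF \<sigma>.unital_ring_map_axioms] var)
  then have fixed: "zeval ?\<sigma> (F T) = F T"
    using T by (rule witt_poly_injective)
  have on_V: "zeval c (F T) = zeval (\<lambda>v. if v \<in> V then c v else 0) (F T)"
    for c :: "_ \<Rightarrow> 'r"
  proof -
    interpret c: unital_ring_map "zeval c" by (rule unital_ring_map_zeval)
    have "zeval c (F T) = zeval (\<lambda>v. zeval c (?\<sigma> v)) (F T)"
      by (subst fixed[symmetric]) (rule c.map_zeval)
    also have "(\<lambda>v. zeval c (?\<sigma> v)) = (\<lambda>v. if v \<in> V then c v else 0)"
      by (auto simp: zeval_zvar c.map_zero)
    finally show ?thesis .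
  qed
  have "(\<lambda>v. if v \<in> V then a v else 0) = (\<lambda>v. if v \<in> V then b v else 0)"
    by (rule ext) (auto simp: V_def Inl Inr)
  then show ?thesis unfolding on_V[of a] on_V[of b] by (rule arg_cong)
qed

lemma UNIV_Lat: "UNIV \<in> Lat"
  by (rule LatI[where N = 0]) (simp_all add: has_level_def)

lemma idx_eq_1_iff:
  assumes "K \<in> Lat"
  shows "idx K = Suc 0 \<longleftrightarrow> K = UNIV"
proof -
  have "idx UNIV = Suc 0" by (simp add: idx_def coset_def)
  then show ?thesis using idx_eq_imp_eq[OF assms UNIV_Lat] by auto
qed

lemma witt_poly_zero:
  assumes T: "T \<in> gclasses G \<tau>"
  shows "witt_poly G \<tau> T (\<lambda>_. 0) = (0 :: 'r::comm_ring_1)"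
proof -
  have "0 < idx (lat T) div idx K" if "K \<in> Lat" "lat T \<subseteq> K" for K
    using lat_Lat[OF T] that by (rule idx_div_pos)
  then show ?thesis
    unfolding witt_poly_eq_plane_witt[OF T] plane_witt_def by (intro sum.neutral ballI) (simp add: zero_power)
qed

lemma witt_poly_one:
  assumes T: "T \<in> gclasses G \<tau>"
  shows "witt_poly G \<tau> T (\<lambda>U. if gcard U = 1 then 1 else 0) = (1 :: 'r::comm_ring_1)"
proof -
  have pos: "0 < idx (lat T) div idx K" if "K \<in> Lat" "lat T \<subseteq> K" for K
    using lat_Lat[OF T] that by (rule idx_div_pos)
  have "witt_poly G \<tau> T (\<lambda>U. if gcard U = 1 then 1 else 0) =
      plane_witt (lat T) (\<lambda>K. if K = UNIV then 1 else (0 :: 'r))"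
    unfolding witt_poly_eq_plane_witt[OF T]
    by (rule plane_witt_cong) (simp add: gcard_eq cls_gclass lat_cls idx_eq_1_iff)
  also have "\<dots> = (\<Sum>K\<in>{K \<in> Lat. lat T \<subseteq> K}. if K = UNIV then 1 else 0)"
    unfolding plane_witt_def
  proof (rule sum.cong[OF refl])
    fix K assume K: "K \<in> {K \<in> Lat. lat T \<subseteq> K}"
    then show "of_nat (idx K) * (if K = UNIV then 1 else 0) ^ (idx (lat T) div idx K) =
        (if K = UNIV then 1 else (0 :: 'r))"
      using pos[of K] idx_eq_1_iff[OF UNIV_Lat] by (simp add: zero_power)
  qed
  also have "\<dots> = 1"
    using finite_supLat[OF lat_Lat[OF T]] UNIV_Lat by simp
  finally show ?thesis .
qed

text \<open>
  The multiples of 1 are reductions of integer Witt vectors with constant ghost components. The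
  induction follows the recursive definition of multiples: each step adds the family of 1.
\<close>

lemma multiple_of_one:
  defines "W \<equiv> witt_burnside_ring G \<tau> TYPE('k::comm_ring_1)"
  obtains P :: "Zp2_class \<Rightarrow> int" where
    "[n] \<cdot>\<^bsub>W\<^esub> \<one>\<^bsub>W\<^esub> = (\<lambda>T\<in>gclasses G \<tau>. of_int (P T))"
    "\<And>T. T \<in> gclasses G \<tau> \<Longrightarrow> witt_poly G \<tau> T P = of_nat n"
proof (induction n arbitrary: thesis)
  case 0
  have "[(0::nat)] \<cdot>\<^bsub>W\<^esub> \<one>\<^bsub>W\<^esub> = (\<lambda>T\<in>gclasses G \<tau>. of_int 0)"
    by (simp add: add_pow_def nat_pow_def W_def witt_burnside_ring_def)
  then show ?case using witt_poly_zero by (intro 0[of "\<lambda>_. 0"]) simp_all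
next
  case (Suc n)
  obtain P :: "Zp2_class \<Rightarrow> int" where
    P: "[n] \<cdot>\<^bsub>W\<^esub> \<one>\<^bsub>W\<^esub> = (\<lambda>T\<in>gclasses G \<tau>. of_int (P T))"
      "\<And>T. T \<in> gclasses G \<tau> \<Longrightarrow> witt_poly G \<tau> T P = of_nat n"
    using Suc.IH by blast
  let ?one = "\<lambda>U. if gcard U = 1 then 1 else 0 :: int"
  let ?Q = "\<lambda>T. zeval (case_sum P ?one) (witt_sum G \<tau> T)"
  interpret i: unital_ring_map "of_int :: int \<Rightarrow> 'k" by (rule unital_ring_map_of_int)
  show ?case
  proof (rule Suc.prems)
    have "[Suc n] \<cdot>\<^bsub>W\<^esub> \<one>\<^bsub>W\<^esub> = [n] \<cdot>\<^bsub>W\<^esub> \<one>\<^bsub>W\<^esub> \<oplus>\<^bsub>W\<^esub> \<one>\<^bsub>W\<^esub>"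
      by (simp add: add_pow_def nat_pow_def)
    also have "\<dots> = (\<lambda>T\<in>gclasses G \<tau>.
        zeval (case_sum (\<lambda>T\<in>gclasses G \<tau>. of_int (P T)) \<one>\<^bsub>W\<^esub>) (witt_sum G \<tau> T))"
      unfolding P(1) by (simp add: W_def witt_burnside_ring_def)
    also have "\<dots> = (\<lambda>T\<in>gclasses G \<tau>. of_int (?Q T))"
    proof (rule restrict_ext)
      fix T assume T: "T \<in> gclasses G \<tau>"
      show "zeval (case_sum (\<lambda>T\<in>gclasses G \<tau>. of_int (P T)) \<one>\<^bsub>W\<^esub>) (witt_sum G \<tau> T) =
          of_int (?Q T)"
        unfolding i.map_zeval
        by (rule zeval_cong_on_gclasses[OF _ _ _ T]) (simp_all add: W_def witt_burnside_ring_def)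
    qed
    finally show "[Suc n] \<cdot>\<^bsub>W\<^esub> \<one>\<^bsub>W\<^esub> = (\<lambda>T\<in>gclasses G \<tau>. of_int (?Q T))" .
    show "witt_poly G \<tau> T ?Q = of_nat (Suc n)" if "T \<in> gclasses G \<tau>" for T
      unfolding zeval_witt_sum_ghost[OF that] using P(2)[OF that] witt_poly_one[OF that, where 'r = int]
      by simp
  qed
qed

text \<open>
  The family \<open>F\<close> stands for the product of \<open>p\<close> and the lift \<open>x n\<close> of \<open>b\<close>, in either order of the
  factors.
\<close>

lemma vanish_at_least_index:
  fixes b :: "Zp2_class \<Rightarrow> 'k::field"
    and F :: "Zp2_class \<Rightarrow> Zp2_class zpoly"
  defines "x n \<equiv> \<lambda>U. if gcard U < n then 0 else zvar U"
  assumes char: "of_nat p = (0 :: 'k)"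
    and F: "\<And>T. T \<in> gclasses G \<tau> \<Longrightarrow> witt_poly G \<tau> T F = of_nat p * witt_poly G \<tau> T (x n)"
    and zero: "\<And>T. T \<in> gclasses G \<tau> \<Longrightarrow> zeval b (F T) = 0"
    and low: "\<And>T. T \<in> gclasses G \<tau> \<Longrightarrow> gcard T < n \<Longrightarrow> b T = 0"
    and T: "T \<in> gclasses G \<tau>" "gcard T = n"
  shows "b T = 0"
proof -
  interpret e: unital_ring_map "zeval b" by (rule unital_ring_map_zeval)
  have card: "gcard (cls L) = idx L" if "L \<in> Lat" for L
    using that by (simp add: gcard_eq cls_gclass lat_cls)
  have ex: "zeval b (x n U) = b U" if "U \<in> gclasses G \<tau>" for U
    using low[OF that] by (simp add: x_def e.map_zero zeval_zvar)
  have "(\<Sum>K\<in>{K \<in> Lat. M \<subseteq> K \<and> idx K = n}. b (cls K) ^ p) = 0"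
    if M: "M \<in> Lat" "idx M = p * n" for M
  proof -
    have "plane_witt L (\<lambda>K. F (cls K)) = of_nat p * plane_witt L (\<lambda>K. x n (cls K))" if "L \<in> Lat" for L
      using F[OF cls_gclass[OF that]] that by (simp add: witt_poly_eq_plane_witt cls_gclass lat_cls)
    then have "of_nat p dvd F (cls M) -
        (\<Sum>K\<in>{K \<in> Lat. M \<subseteq> K \<and> idx K = n}. x n (cls K) ^ p)"
      by (rule p_multiple_mod_p[OF _ _ M]) (simp_all add: x_def card)
    then obtain z where "F (cls M) -
        (\<Sum>K\<in>{K \<in> Lat. M \<subseteq> K \<and> idx K = n}. x n (cls K) ^ p) = of_nat p * z"
      by (rule dvdE)
    then have "zeval b (F (cls M) -
        (\<Sum>K\<in>{K \<in> Lat. M \<subseteq> K \<and> idx K = n}. x n (cls K) ^ p)) = zeval b (of_nat p * z)"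
      by (rule arg_cong)
    then show ?thesis
      using zero[OF cls_gclass[OF M(1)]]
      by (simp add: e.map_diff e.map_sum e.map_power e.map_mult e.map_of_nat char ex cls_gclass)
  qed
  then have "b (cls (lat T)) = 0"
    by (rule vanish_of_upper_sums) (use T in \<open>simp_all add: lat_Lat gcard_eq\<close>)
  then show ?thesis using T(1) by (simp add: cls_lat)
qed

lemma p_not_zero_divisor:
  assumes char: "of_nat p = (0 :: 'k::field)"
  defines "W \<equiv> witt_burnside_ring G \<tau> TYPE('k)"
  shows "\<not> zero_divisor W ([p] \<cdot>\<^bsub>W\<^esub> \<one>\<^bsub>W\<^esub>)"
proof
  obtain P :: "Zp2_class \<Rightarrow> int" where
    P: "[p] \<cdot>\<^bsub>W\<^esub> \<one>\<^bsub>W\<^esub> = (\<lambda>T\<in>gclasses G \<tau>. of_int (P T))"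
    and ghost_P: "\<And>T. T \<in> gclasses G \<tau> \<Longrightarrow> witt_poly G \<tau> T P = of_nat p"
    using multiple_of_one unfolding W_def by blast
  let ?P = "[p] \<cdot>\<^bsub>W\<^esub> \<one>\<^bsub>W\<^esub>"
  assume "zero_divisor W ?P"
  then obtain b where b: "b \<in> carrier W" "b \<noteq> \<zero>\<^bsub>W\<^esub>"
    and zero: "?P \<otimes>\<^bsub>W\<^esub> b = \<zero>\<^bsub>W\<^esub> \<or> b \<otimes>\<^bsub>W\<^esub> ?P = \<zero>\<^bsub>W\<^esub>"
    by (auto simp: zero_divisor_def)
  have "\<exists>T\<in>gclasses G \<tau>. b T \<noteq> 0"
  proof (rule ccontr)
    assume "\<not> (\<exists>T\<in>gclasses G \<tau>. b T \<noteq> 0)"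
    then have "b = \<zero>\<^bsub>W\<^esub>"
      using b(1) by (intro extensionalityI[of _ "gclasses G \<tau>"])
        (auto simp: W_def witt_burnside_ring_def PiE_def)
    then show False using b(2) by simp
  qed
  then obtain T where T: "T \<in> gclasses G \<tau>" "b T \<noteq> 0"
    and least: "\<And>U. U \<in> gclasses G \<tau> \<Longrightarrow> b U \<noteq> 0 \<Longrightarrow> gcard T \<le> gcard U"
    using ex_has_least_nat[of "\<lambda>T. T \<in> gclasses G \<tau> \<and> b T \<noteq> 0" _ gcard] by blast
  define x :: "Zp2_class \<Rightarrow> Zp2_class zpoly"
    where "x = (\<lambda>U. if gcard U < gcard T then 0 else zvar U)"
  interpret e: unital_ring_map "zeval b" by (rule unital_ring_map_zeval)
  have low: "b U = 0" if "U \<in> gclasses G \<tau>" "gcard U < gcard T" for U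
    using least that by (meson not_le)
  have ex: "zeval b (x U) = b U" if "U \<in> gclasses G \<tau>" for U
    using low[OF that] by (simp add: x_def e.map_zero zeval_zvar)
  \<comment> \<open>The polynomial lift of \<open>p\<close>; its ghost components are \<open>p\<close> because those of \<open>P\<close> are.\<close>
  let ?p = "\<lambda>U. of_int (P U) :: Zp2_class zpoly"
  have ghost_p: "witt_poly G \<tau> U ?p = of_nat p" if "U \<in> gclasses G \<tau>" for U
    using ghost_P[OF that] by (simp flip: map_witt_poly[OF unital_ring_map_of_int])
  have vanish: "b T = 0"
    if "\<And>U. U \<in> gclasses G \<tau> \<Longrightarrow> witt_poly G \<tau> U F = of_nat p * witt_poly G \<tau> U x"
      and "\<And>U. U \<in> gclasses G \<tau> \<Longrightarrow> zeval b (F U) = 0" for F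
    using char that(1)[unfolded x_def] that(2) low T(1) refl by (rule vanish_at_least_index)
  from zero show False
  proof
    assume prod: "?P \<otimes>\<^bsub>W\<^esub> b = \<zero>\<^bsub>W\<^esub>"
    let ?F = "\<lambda>U. zeval (case_sum ?p x) (witt_prod G \<tau> U)"
    have "zeval b (?F U) = 0" if U: "U \<in> gclasses G \<tau>" for U
    proof -
      have "zeval b (?F U) = zeval (case_sum ?P b) (witt_prod G \<tau> U)"
        unfolding e.map_zeval
        by (rule zeval_cong_on_gclasses[OF _ _ _ U]) (simp_all add: P e.map_of_int ex)
      also have "\<dots> = (?P \<otimes>\<^bsub>W\<^esub> b) U" using U by (simp add: W_def witt_burnside_ring_def)
      also have "\<dots> = 0" unfolding prod using U by (simp add: W_def witt_burnside_ring_def)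
      finally show ?thesis .
    qed
    then have "b T = 0"
      by (intro vanish[of ?F]) (simp_all add: zeval_witt_prod_ghost ghost_p)
    then show False using T(2) by simp
  next
    assume prod: "b \<otimes>\<^bsub>W\<^esub> ?P = \<zero>\<^bsub>W\<^esub>"
    let ?F = "\<lambda>U. zeval (case_sum x ?p) (witt_prod G \<tau> U)"
    have "zeval b (?F U) = 0" if U: "U \<in> gclasses G \<tau>" for U
    proof -
      have "zeval b (?F U) = zeval (case_sum b ?P) (witt_prod G \<tau> U)"
        unfolding e.map_zeval
        by (rule zeval_cong_on_gclasses[OF _ _ _ U]) (simp_all add: P e.map_of_int ex)
      also have "\<dots> = (b \<otimes>\<^bsub>W\<^esub> ?P) U" using U by (simp add: W_def witt_burnside_ring_def)
      also have "\<dots> = 0" unfolding prod using U by (simp add: W_def witt_burnside_ring_def)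
      finally show ?thesis .
    qed
    then have "b T = 0"
      by (intro vanish[of ?F]) (simp_all add: zeval_witt_prod_ghost ghost_p mult.commute)
    then show False using T(2) by simp
  qed
qed

end

theorem corollary4p8:
  fixes p :: nat
  assumes "prime p"
    and "CHAR('k::field) = p"
  defines "W \<equiv> witt_burnside_ring (Zp2 p) (Zp2_topology p) TYPE('k)"
  shows "\<not> zero_divisor W ([p] \<cdot>\<^bsub>W\<^esub> \<one>\<^bsub>W\<^esub>)"
proof -
  interpret prime_index p using assms(1) by unfold_locales
  have "of_nat p = (0 :: 'k)" using assms(2) of_nat_CHAR by blast
  then show ?thesis unfolding W_def by (rule p_not_zero_divisor)
qed

end
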